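(* Let $n\ge1$, $m\ge1$, $N=2^n$, $M=2^m\ne 4$. For a tuple $(\alpha,\beta,\gamma,\delta,r,s,c)\in\mathbb{Z}_N^4\times\mathbb{Z}_N^2\times\mathbb{Z}_M$ with $Z=\begin{pmatrix}\alpha&\beta\\ \gamma&\delta\end{pmatrix}\in\mathrm{GL}_2(\mathbb{Z}_N)$, let $G$ be the group defined by the presentation $$G=\left\langle a,b,t,z \;\middle|\; \begin{array}{l} a^N=b^N=t^2=z^M=1,\ [a,b]=1,\\ a^t=b,\ b^t=a,\\ a^z=a^{\alpha}b^{\beta},\ b^z=a^{\gamma}b^{\delta},\\ t^z=t\,z^{2c}a^{r}b^{s}\end{array}\right\rangle ,$$ and put $H=\langle a,b,t\rangle$, $K=\langle z\rangle$, $B=\langle a,b\rangle$ (subgroups of $G$), $J=\begin{pmatrix}0&1\\1&0\end{pmatrix}$ and $k:=1-2c$. Then $G=HK$ is an exact product with $H\cong\mathrm{W}_{2^n}$, $K\cong C_{2^m}$ and $B$ normal in $G$ if and only if the following conditions hold: 1. $A_M\alpha+B_M\equiv1,\ A_M\beta\equiv0,\ A_M\gamma\equiv0,\ A_M\delta+B_M\equiv1\pmod N$; 2. $A_k\alpha+B_k\equiv\delta,\ A_k\beta\equiv\gamma,\ A_k\gamma\equiv\beta,\ A_k\delta+B_k\equiv\alpha\pmod N$; 3. $(1-2c)^2\equiv1\pmod M$; 4. $(r,s)\,Z^{-2c}\bigl(S_k(Z^k)+J\bigr)\equiv(0,0)\pmod N$; 5. $(r,s)\,Z^{-2c}\,S_M(Z^k)\equiv(0,0)\pmod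 N$. Equivalently, condition 4 reads $\bigl(S_k(Z^k)^{\mathsf T}+J\bigr)(Z^{-2c})^{\mathsf T}\binom{r}{s}\equiv\binom00\pmod N$.
   Context: All groups are finite; $g^h=h^{-1}gh$, $[g,h]=g^{-1}h^{-1}gh$; $\mathbb{Z}_N=\mathbb{Z}/N\mathbb{Z}$. The wreathed $2$-group is $\mathrm{W}_{2^n}=C_{2^n}\wr C_2=\langle a,b,t\mid a^N=b^N=t^2=1,\ [a,b]=1,\ a^t=b,\ b^t=a\rangle$, of order $2N^2$, with base $\langle a\rangle\times\langle b\rangle\cong(\mathbb{Z}_N)^2$. A product $G=HK$ of subgroups is exact if $H\cap K=\{1\}$. $Z$ acts on row exponent vectors by right multiplication: $(a^ib^j)^z$ corresponds to $(i,j)Z=(i\alpha+j\gamma,\ i\beta+j\delta)$. Put $\tau=\alpha+\delta$ and $\nu=\alpha\delta-\beta\gamma$. The sequences $(A_j)_{j\ge0}$, $(B_j)_{j\ge0}$ (taken modulo $N$) are defined by $A_0=0$, $A_1=1$, $A_{j+1}=\tau A_j-\nu A_{j-1}$ for $j\ge 1$, and $B_0=1$, $B_j=-\nu A_{j-1}$ for $j\ge1$; thus $Z^j=A_jZ+B_jI$ for all $j\ge0$. For a positive integer $l$, $S_l(X):=I+X+\cdots+X^{l-1}$. In $A_k$, $B_k$, $Z^k$ and $S_k(Z^k)$ the integer $k$ is the representative of $1-2c$ modulo $M$ in $\{0,1,\dots,M-1\}$ (it is odd, hence positive); condition 1 says $Z^M=I$, so $Z^{-2c}$ is well defined for $c\in\mathbb{Z}_M$.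 *)

theory Defs
  imports
    "HOL-Analysis.Analysis"
    "HOL-Number_Theory.Cong"
    "HOL-Algebra.Elementary_Groups"
begin

section \<open>Groups given by generators and relations\<close>

text \<open>A group word is a list of letters; the letter \<open>(x, True)\<close> is the generator \<open>x\<close> and
  \<open>(x, False)\<close> is its formal inverse.\<close>

type_synonym 'g gword = "('g \<times> bool) list"

definition gen :: "'g \<Rightarrow> 'g gword" where
  "gen x = [(x, True)]"

definition winv :: "'g gword \<Rightarrow> 'g gword" where
  "winv w = rev (map (\<lambda>(x, e). (x, \<not> e)) w)"

definition wpow :: "'g gword \<Rightarrow> int \<Rightarrow> 'g gword" where
  "wpow w i = concat (replicate (nat \<bar>i\<bar>) (if 0 \<le> i then w else winv w))"

definition wconj :: "'g gword \<Rightarrow> 'g gword \<Rightarrow> 'g gword" where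
  "wconj g h = winv h @ g @ h"

definition wcomm :: "'g gword \<Rightarrow> 'g gword \<Rightarrow> 'g gword" where
  "wcomm g h = winv g @ winv h @ g @ h"

text \<open>A set \<open>R\<close> of pairs of words stands for the set of relations \<open>p = q\<close> with \<open>(p, q) \<in> R\<close>. Two
  words are equal in the presented group iff they are related by the congruence generated by \<open>R\<close>
  and by free cancellation. The generators are all elements of the type \<open>'g\<close>.\<close>

inductive pres_eq :: "('g gword \<times> 'g gword) set \<Rightarrow> 'g gword \<Rightarrow> 'g gword \<Rightarrow> bool"
  for R where
  refl: "pres_eq R u u"
| sym: "pres_eq R u v \<Longrightarrow> pres_eq R v u"
| trans: "pres_eq R u v \<Longrightarrow> pres_eq R v w \<Longrightarrow> pres_eq R u w"
| cancel: "pres_eq R (u @ [(x, e), (x, \<not> e)] @ v) (u @ v)"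
| rel: "(p, q) \<in> R \<Longrightarrow> pres_eq R (u @ p @ v) (u @ q @ v)"

definition pres_class :: "('g gword \<times> 'g gword) set \<Rightarrow> 'g gword \<Rightarrow> 'g gword set" where
  "pres_class R u = {v. pres_eq R u v}"

definition presented_group :: "('g gword \<times> 'g gword) set \<Rightarrow> 'g gword set monoid" where
  "presented_group R =
     \<lparr>carrier = range (pres_class R),
      monoid.mult = (\<lambda>X Y. \<Union>u\<in>X. \<Union>v\<in>Y. pres_class R (u @ v)),
      one = pres_class R []\<rparr>"

lemma pres_class_eq_iff: "pres_class R u = pres_class R v \<longleftrightarrow> pres_eq R u v"
  unfolding pres_class_def
  by (metis (no_types, lifting) Collect_cong mem_Collect_eq pres_eq.refl pres_eq.sym pres_eq.trans)

lemma pres_eq_append_left: "pres_eq R u v \<Longrightarrow> pres_eq R (w @ u) (w @ v)"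
proof (induction rule: pres_eq.induct)
  case (cancel u x e v)
  show ?case using pres_eq.cancel[of R "w @ u" x e v] by simp
next
  case (rel p q u v)
  then show ?case using pres_eq.rel[of p q R "w @ u" v] by simp
qed (metis pres_eq.refl, metis pres_eq.sym, metis pres_eq.trans)

lemma pres_eq_append_right: "pres_eq R u v \<Longrightarrow> pres_eq R (u @ w) (v @ w)"
proof (induction rule: pres_eq.induct)
  case (cancel u x e v)
  show ?case using pres_eq.cancel[of R u x e "v @ w"] by simp
next
  case (rel p q u v)
  then show ?case using pres_eq.rel[of p q R u "v @ w"] by simp
qed (metis pres_eq.refl, metis pres_eq.sym, metis pres_eq.trans)

lemma presented_group_mult:
  "pres_class R u \<otimes>\<^bsub>presented_group R\<^esub> pres_class R v = pres_class R (u @ v)"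
proof -
  have *: "pres_class R (u' @ v') = pres_class R (u @ v)"
    if "u' \<in> pres_class R u" "v' \<in> pres_class R v" for u' v'
  proof -
    have "pres_eq R u u'" "pres_eq R v v'" using that by (simp_all add: pres_class_def)
    then have "pres_eq R (u @ v) (u' @ v')"
      using pres_eq.trans[OF pres_eq_append_right[of R u u' v] pres_eq_append_left[of R v v' u']]
      by simp
    then show ?thesis by (simp add: pres_class_eq_iff pres_eq.sym)
  qed
  have "pres_class R u \<otimes>\<^bsub>presented_group R\<^esub> pres_class R v
      = (\<Union>u'\<in>pres_class R u. \<Union>v'\<in>pres_class R v. pres_class R (u @ v))"
    unfolding presented_group_def monoid.simps by (intro SUP_cong HOL.refl *)
  moreover have "u \<in> pres_class R u" "v \<in> pres_class R v"
    by (simp_all add: pres_class_def pres_eq.refl)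
  then have "pres_class R u \<noteq> {}" "pres_class R v \<noteq> {}" by blast+
  ultimately show ?thesis by simp
qed

lemma winv_Cons: "winv (l # w) = winv w @ [(fst l, \<not> snd l)]"
  by (simp add: winv_def case_prod_beta)

lemma pres_eq_winv_left: "pres_eq R (winv w @ w) []"
proof (induction w)
  case Nil
  show ?case by (simp add: winv_def pres_eq.refl)
next
  case (Cons l w)
  have "pres_eq R (winv (l # w) @ l # w) (winv w @ w)"
    using pres_eq.cancel[of R "winv w" "fst l" "\<not> snd l" w] by (simp add: winv_Cons)
  from pres_eq.trans[OF this Cons] show ?case .
qed

lemma group_presented_group: "group (presented_group R)"
proof (rule groupI)
  fix X assume "X \<in> carrier (presented_group R)"
  then obtain w where X: "X = pres_class R w" by (auto simp: presented_group_def)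
  have "pres_class R (winv w) \<otimes>\<^bsub>presented_group R\<^esub> X = \<one>\<^bsub>presented_group R\<^esub>"
    unfolding X presented_group_mult
    by (simp add: presented_group_def pres_class_eq_iff pres_eq_winv_left)
  then show "\<exists>Y\<in>carrier (presented_group R). Y \<otimes>\<^bsub>presented_group R\<^esub> X = \<one>\<^bsub>presented_group R\<^esub>"
    by (auto simp: presented_group_def)
next
  fix X Y assume "X \<in> carrier (presented_group R)" "Y \<in> carrier (presented_group R)"
  then obtain u v where "X = pres_class R u" "Y = pres_class R v"
    by (auto simp: presented_group_def)
  then show "X \<otimes>\<^bsub>presented_group R\<^esub> Y \<in> carrier (presented_group R)"
    by (simp add: presented_group_mult) (simp add: presented_group_def)
next
  show "\<one>\<^bsub>presented_group R\<^esub> \<in> carrier (presented_group R)"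
    by (simp add: presented_group_def)
next
  fix X Y Z assume "X \<in> carrier (presented_group R)" "Y \<in> carrier (presented_group R)"
    "Z \<in> carrier (presented_group R)"
  then obtain u v w where "X = pres_class R u" "Y = pres_class R v" "Z = pres_class R w"
    by (auto simp: presented_group_def)
  then show "X \<otimes>\<^bsub>presented_group R\<^esub> Y \<otimes>\<^bsub>presented_group R\<^esub> Z
           = X \<otimes>\<^bsub>presented_group R\<^esub> (Y \<otimes>\<^bsub>presented_group R\<^esub> Z)"
    by (simp add: presented_group_mult)
next
  fix X assume "X \<in> carrier (presented_group R)"
  then obtain w where X: "X = pres_class R w" by (auto simp: presented_group_def)
  have "\<one>\<^bsub>presented_group R\<^esub> = pres_class R []" by (simp add: presented_group_def)
  with X show "\<one>\<^bsub>presented_group R\<^esub> \<otimes>\<^bsub>presented_group R\<^esub> X = X"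
    by (simp add: presented_group_mult)
qed


section \<open>The wreathed 2-group and the group of the theorem\<close>

definition wreath_relations ::
  "nat \<Rightarrow> 'g gword \<Rightarrow> 'g gword \<Rightarrow> 'g gword \<Rightarrow> ('g gword \<times> 'g gword) set" where
  "wreath_relations N a b t =
     {(wpow a (int N), []), (wpow b (int N), []), (wpow t 2, []),
      (wcomm a b, []),
      (wconj a t, b), (wconj b t, a)}"

datatype wreath_gen = Wa | Wb | Wt

definition wreathed_group :: "nat \<Rightarrow> wreath_gen gword set monoid" where
  "wreathed_group n = presented_group (wreath_relations (2 ^ n) (gen Wa) (gen Wb) (gen Wt))"

datatype ext_gen = Ga | Gb | Gt | Gz

text \<open>The parameters are integer representatives of residue classes: \<open>\<alpha>, \<beta>, \<gamma>, \<delta>, r, s\<close> modulo \<open>N\<close>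
  and \<open>c\<close> modulo \<open>M\<close>. Since \<open>a\<^sup>N = b\<^sup>N = z\<^sup>M = 1\<close> are among the relations, the presented group depends
  only on the classes.\<close>

definition ext_relations ::
  "nat \<Rightarrow> nat \<Rightarrow> int \<Rightarrow> int \<Rightarrow> int \<Rightarrow> int \<Rightarrow> int \<Rightarrow> int \<Rightarrow> int \<Rightarrow> (ext_gen gword \<times> ext_gen gword) set" where
  "ext_relations N M \<alpha> \<beta> \<gamma> \<delta> r s c =
     (let a = gen Ga; b = gen Gb; t = gen Gt; z = gen Gz in
      wreath_relations N a b t \<union>
      {(wpow z (int M), []),
       (wconj a z, wpow a \<alpha> @ wpow b \<beta>),
       (wconj b z, wpow a \<gamma> @ wpow b \<delta>),
       (wconj t z, t @ wpow z (2 * c) @ wpow a r @ wpow b s)})"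

definition ext_group ::
  "nat \<Rightarrow> nat \<Rightarrow> int \<Rightarrow> int \<Rightarrow> int \<Rightarrow> int \<Rightarrow> int \<Rightarrow> int \<Rightarrow> int \<Rightarrow> ext_gen gword set monoid" where
  "ext_group N M \<alpha> \<beta> \<gamma> \<delta> r s c = presented_group (ext_relations N M \<alpha> \<beta> \<gamma> \<delta> r s c)"

definition ext_elem ::
  "nat \<Rightarrow> nat \<Rightarrow> int \<Rightarrow> int \<Rightarrow> int \<Rightarrow> int \<Rightarrow> int \<Rightarrow> int \<Rightarrow> int \<Rightarrow> ext_gen \<Rightarrow> ext_gen gword set" where
  "ext_elem N M \<alpha> \<beta> \<gamma> \<delta> r s c x = pres_class (ext_relations N M \<alpha> \<beta> \<gamma> \<delta> r s c) (gen x)"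

definition exact_product :: "('a, 'b) monoid_scheme \<Rightarrow> 'a set \<Rightarrow> 'a set \<Rightarrow> bool" where
  "exact_product G H K \<longleftrightarrow>
     subgroup H G \<and> subgroup K G \<and> carrier G = H <#>\<^bsub>G\<^esub> K \<and> H \<inter> K = {\<one>\<^bsub>G\<^esub>}"


section \<open>Matrices modulo N\<close>

text \<open>Matrices and vectors over the residue ring modulo \<open>N\<close> are represented by integer matrices and
  vectors up to entrywise congruence. The product of matrices is \<open>**\<close> and the identity is \<open>mat 1\<close>
  (the class operations \<open>*\<close> and \<open>1\<close> on vectors are entrywise).\<close>

definition mat2 :: "int \<Rightarrow> int \<Rightarrow> int \<Rightarrow> int \<Rightarrow> int ^ 2 ^ 2" where
  "mat2 p q u v = vector [vector [p, q], vector [u, v]]"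

definition vec_cong :: "nat \<Rightarrow> int ^ 2 \<Rightarrow> int ^ 2 \<Rightarrow> bool" where
  "vec_cong N x y \<longleftrightarrow> (\<forall>i. [x $ i = y $ i] (mod int N))"

definition mat_cong :: "nat \<Rightarrow> int ^ 2 ^ 2 \<Rightarrow> int ^ 2 ^ 2 \<Rightarrow> bool" where
  "mat_cong N X Y \<longleftrightarrow> (\<forall>i j. [X $ i $ j = Y $ i $ j] (mod int N))"

definition in_GL2 :: "nat \<Rightarrow> int ^ 2 ^ 2 \<Rightarrow> bool" where
  "in_GL2 N X \<longleftrightarrow> (\<exists>Y. mat_cong N (X ** Y) (mat 1) \<and> mat_cong N (Y ** X) (mat 1))"

primrec mat_power :: "int ^ 2 ^ 2 \<Rightarrow> nat \<Rightarrow> int ^ 2 ^ 2" where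
  "mat_power X 0 = mat 1"
| "mat_power X (Suc j) = mat_power X j ** X"

definition S_mat :: "nat \<Rightarrow> int ^ 2 ^ 2 \<Rightarrow> int ^ 2 ^ 2" where
  "S_mat l X = (\<Sum>i<l. mat_power X i)"

fun A_seq :: "int \<Rightarrow> int \<Rightarrow> nat \<Rightarrow> int" where
  "A_seq \<tau> \<nu> 0 = 0"
| "A_seq \<tau> \<nu> (Suc 0) = 1"
| "A_seq \<tau> \<nu> (Suc (Suc j)) = \<tau> * A_seq \<tau> \<nu> (Suc j) - \<nu> * A_seq \<tau> \<nu> j"

fun B_seq :: "int \<Rightarrow> int \<Rightarrow> nat \<Rightarrow> int" where
  "B_seq \<tau> \<nu> 0 = 1"
| "B_seq \<tau> \<nu> (Suc j) = - \<nu> * A_seq \<tau> \<nu> j"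

lemma mat_power_A_B:
  fixes \<alpha> \<beta> \<gamma> \<delta> :: int
  defines "\<tau> \<equiv> \<alpha> + \<delta>" and "\<nu> \<equiv> \<alpha> * \<delta> - \<beta> * \<gamma>"
  shows "mat_power (mat2 \<alpha> \<beta> \<gamma> \<delta>) j =
    mat2 (A_seq \<tau> \<nu> j * \<alpha> + B_seq \<tau> \<nu> j) (A_seq \<tau> \<nu> j * \<beta>)
         (A_seq \<tau> \<nu> j * \<gamma>) (A_seq \<tau> \<nu> j * \<delta> + B_seq \<tau> \<nu> j)"
proof (induction j)
  case 0
  show ?case by (simp add: vec_eq_iff forall_2 mat2_def mat_def)
next
  case (Suc j)
  have mult: "mat2 p q u v ** mat2 p' q' u' v' =
      mat2 (p * p' + q * u') (p * q' + q * v') (u * p' + v * u') (u * q' + v * v')"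
    for p q u v p' q' u' v'
    by (simp add: vec_eq_iff forall_2 mat2_def matrix_matrix_mult_def sum_2)
  have cong: "mat2 p q u v = mat2 p' q' u' v'" if "p = p'" "q = q'" "u = u'" "v = v'"
    for p q u v p' q' u' v'
    using that by simp
  show ?case
    unfolding mat_power.simps(2) Suc mult
    by (rule cong; cases j; simp add: \<tau>_def \<nu>_def algebra_simps)
qed

end

theory Submission
  imports Defs "HOL-Algebra.Multiplicative_Group"
begin

text \<open>Elements of the base are written additively, as row vectors modulo \<open>N\<close>. Then \<open>t\<close> acts on the
base as the swap \<open>J\<close> and \<open>z\<close> acts as \<open>Z\<close>, and the last relation, solved for \<open>z t\<close>, becomes
\<open>z\<^sup>t = z\<^sup>k u\<close> with \<open>u = - (r, s) Z\<^bsup>-2c\<^esup>\<close>. So \<open>G\<close> ought to be the extension of the semidirect product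
of the base and \<open>\<langle>z\<rangle>\<close> by the involution \<open>v \<mapsto> v J\<close>, \<open>z \<mapsto> z\<^sup>k u\<close>, and the five conditions say that this
recipe makes sense: \<open>Z\<^sup>M = I\<close> (the semidirect product exists), \<open>Z J = J Z\<^sup>k\<close> (the action of \<open>z\<close> on the
base is respected), \<open>k\<^sup>2 = 1\<close> together with \<open>u (S\<^sub>k(Z\<^sup>k) + J) = 0\<close> (the map is an involution, since
\<open>(z\<^sup>k u)\<^sup>k\<close> followed by \<open>u J\<close> is \<open>z\<^bsup>k k\<^esup> u (S\<^sub>k(Z\<^sup>k) + J)\<close>), and \<open>u S\<^sub>M(Z\<^sup>k) = 0\<close> (the image of
\<open>z\<close> has order dividing \<open>M\<close>).

The relations imply that every element has the form \<open>t\<^sup>\<epsilon> z\<^sup>j w\<close> with \<open>w\<close> in the base, that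
\<open>G = H K\<close> and that the base is normal (\<open>generate_product\<close>, \<open>base_normal\<close>). What the left-hand side
of the equivalence adds is that this normal form is unique modulo \<open>N\<close> and \<open>M\<close>: \<open>H\<close> is the wreathed
group iff it has the full order \<open>2 N\<^sup>2\<close>, \<open>K\<close> is cyclic of order \<open>M\<close> iff \<open>z\<close> has that order, and \<open>H\<close>
and \<open>K\<close> meet trivially.

If the normal form is unique, the five conditions are read off by computing \<open>v z\<^sup>M\<close>, \<open>v z t\<close>,
\<open>z t t\<close> and \<open>z\<^sup>M t\<close> in two ways (\<open>normal_form_unique_imp_consistent\<close>). Conversely, the formulas for
right multiplication of a normal form by a generator define an action of words on triples
\<open>(\<epsilon>, j, w)\<close>; under the five conditions every defining relation acts trivially modulo \<open>M\<close> and \<open>N\<close>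
(\<open>relation_act\<close>), so that distinct triples are distinct elements of \<open>G\<close>. The order of the wreathed
group itself is obtained in the same way, from the case \<open>M = 1\<close> with \<open>Z = I\<close>.\<close>

section \<open>Evaluating words in a group\<close>

definition word_eval :: "('a, 'b) monoid_scheme \<Rightarrow> ('g \<Rightarrow> 'a) \<Rightarrow> 'g gword \<Rightarrow> 'a" where
  "word_eval G f w =
     foldr (\<lambda>(x, e) y. (if e then f x else inv\<^bsub>G\<^esub> (f x)) \<otimes>\<^bsub>G\<^esub> y) w \<one>\<^bsub>G\<^esub>"

locale word_valuation = group G for G (structure) +
  fixes f :: "'g \<Rightarrow> 'a"
  assumes f_closed [simp]: "f x \<in> carrier G"
begin

lemma word_eval_Nil [simp]: "word_eval G f [] = \<one>"
  by (simp add: word_eval_def)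

lemma word_eval_closed: "word_eval G f w \<in> carrier G"
  by (induction w) (auto simp: word_eval_def)

lemma word_eval_append: "word_eval G f (u @ v) = word_eval G f u \<otimes> word_eval G f v"
proof (induction u)
  case Nil
  show ?case using word_eval_closed[of v] by (simp add: word_eval_def)
next
  case (Cons l u)
  then show ?case
    using word_eval_closed[of u] word_eval_closed[of v]
    by (cases l) (auto simp: word_eval_def m_assoc)
qed

lemma word_eval_gen: "word_eval G f (gen x) = f x"
  by (auto simp: word_eval_def gen_def)

lemma word_eval_winv: "word_eval G f (winv w) = inv (word_eval G f w)"
proof (induction w)
  case Nil
  show ?case by (simp add: winv_def)
next
  case (Cons l w)
  obtain x e where l: "l = (x, e)" by (cases l)
  have "word_eval G f (winv (l # w)) = inv (word_eval G f w) \<otimes> word_eval G f [(x, \<not> e)]"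
    by (simp add: winv_Cons word_eval_append Cons l)
  also have "word_eval G f [(x, \<not> e)] = inv (word_eval G f [(x, e)])"
    by (auto simp: word_eval_def)
  also have "inv (word_eval G f w) \<otimes> inv (word_eval G f [(x, e)])
      = inv (word_eval G f ([(x, e)] @ w))"
    by (simp only: word_eval_append inv_mult_group[OF word_eval_closed word_eval_closed])
  finally show ?case by (simp add: l)
qed

lemma word_eval_wpow: "word_eval G f (wpow w i) = word_eval G f w [^] i"
proof -
  have rep: "word_eval G f (concat (replicate n v)) = word_eval G f v [^] n" for n :: nat and v
  proof (induction n)
    case (Suc n)
    then show ?case
      using nat_pow_mult[OF word_eval_closed[of v], of 1 n]
      by (simp add: word_eval_append word_eval_closed)
  qed simp
  show ?thesis
  proof (cases "0 \<le> i")
    case False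
    then have "word_eval G f w [^] i = inv (word_eval G f w [^] nat (- i))"
      by (simp only: int_pow_def2 not_le if_True)
    also have "\<dots> = inv (word_eval G f w) [^] nat (- i)"
      by (rule nat_pow_inv[OF word_eval_closed, symmetric])
    finally show ?thesis
      using False by (simp add: wpow_def rep word_eval_winv)
  next
    case True
    then have "word_eval G f w [^] i = word_eval G f w [^] nat i"
      by (simp only: int_pow_def2 not_less[symmetric] if_False)
    then show ?thesis
      using True by (simp add: wpow_def rep)
  qed
qed

lemma word_eval_wconj:
  "word_eval G f (wconj u v) = inv (word_eval G f v) \<otimes> word_eval G f u \<otimes> word_eval G f v"
  by (simp add: wconj_def word_eval_append word_eval_winv m_assoc word_eval_closed)

lemma word_eval_wcomm:
  "word_eval G f (wcomm u v)
     = inv (word_eval G f u) \<otimes> inv (word_eval G f v) \<otimes> word_eval G f u \<otimes> word_eval G f v"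
  by (simp add: wcomm_def word_eval_append word_eval_winv m_assoc word_eval_closed)

lemmas word_eval_simps = word_eval_append word_eval_gen word_eval_winv word_eval_wpow
  word_eval_wconj word_eval_wcomm

lemma range_word_eval: "range (word_eval G f) = generate G (range f)"
proof
  show "range (word_eval G f) \<subseteq> generate G (range f)"
  proof (rule image_subsetI)
    fix w show "word_eval G f w \<in> generate G (range f)"
    proof (induction w)
      case (Cons l w)
      then show ?case
        by (cases l) (auto simp: word_eval_def intro: generate.intros)
    qed (simp add: generate.one)
  qed
next
  have "subgroup (range (word_eval G f)) G"
  proof (rule subgroupI)
    show "range (word_eval G f) \<subseteq> carrier G"
      by (auto simp: word_eval_closed)
    show "inv x \<in> range (word_eval G f)" if "x \<in> range (word_eval G f)" for x
      using that by (auto simp flip: word_eval_winv)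
    show "x \<otimes> y \<in> range (word_eval G f)"
      if "x \<in> range (word_eval G f)" "y \<in> range (word_eval G f)" for x y
      using that by (auto simp flip: word_eval_append)
  qed simp
  moreover have "range f \<subseteq> range (word_eval G f)"
    by (auto simp flip: word_eval_gen)
  ultimately show "generate G (range f) \<subseteq> range (word_eval G f)"
    using generate_subgroup_incl by blast
qed

lemma word_eval_cong_pres_eq:
  assumes "\<And>p q. (p, q) \<in> R \<Longrightarrow> word_eval G f p = word_eval G f q" and "pres_eq R u v"
  shows "word_eval G f u = word_eval G f v"
  using assms(2)
proof (induction rule: pres_eq.induct)
  case (cancel u x e v)
  have "word_eval G f [(x, e), (x, \<not> e)] = \<one>"
    by (simp add: word_eval_def)
  then show ?case
    by (simp only: word_eval_append l_one word_eval_closed)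
qed (simp_all add: word_eval_append assms(1))

text \<open>Von Dyck's theorem: elements of \<open>G\<close> that satisfy the relations receive a homomorphism from the
presented group.\<close>

lemma presented_group_universal:
  assumes "\<And>p q. (p, q) \<in> R \<Longrightarrow> word_eval G f p = word_eval G f q"
  obtains h where "h \<in> hom (presented_group R) G"
    and "\<And>w. h (pres_class R w) = word_eval G f w"
proof -
  define h where "h X = word_eval G f (SOME w. X = pres_class R w)" for X
  have h: "h (pres_class R w) = word_eval G f w" for w
  proof -
    have "pres_class R w = pres_class R (SOME v. pres_class R w = pres_class R v)"
      by (rule someI) (rule HOL.refl)
    then show ?thesis
      unfolding h_def pres_class_eq_iff using word_eval_cong_pres_eq[OF assms] by metis
  qed
  have "h \<in> hom (presented_group R) G"
  proof (rule homI)
    show "h X \<in> carrier G" for X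
      by (simp add: h_def word_eval_closed)
    fix X Y assume "X \<in> carrier (presented_group R)" "Y \<in> carrier (presented_group R)"
    then obtain u v where "X = pres_class R u" "Y = pres_class R v"
      by (auto simp: presented_group_def)
    then show "h (X \<otimes>\<^bsub>presented_group R\<^esub> Y) = h X \<otimes> h Y"
      by (simp add: presented_group_mult h word_eval_append)
  qed
  with h that show ?thesis by blast
qed

end

lemma pres_class_closed: "pres_class R w \<in> carrier (presented_group R)"
  by (simp add: presented_group_def)

lemma word_valuation_presented_group:
  "word_valuation (presented_group R) (\<lambda>x. pres_class R (gen x))"
  by (intro word_valuation.intro word_valuation_axioms.intro group_presented_group)
    (auto simp: pres_class_closed)

lemma word_eval_presented_group:
  "word_eval (presented_group R) (\<lambda>x. pres_class R (gen x)) w = pres_class R w"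
proof (induction w)
  case Nil
  show ?case by (simp add: word_eval_def presented_group_def)
next
  case (Cons l w)
  interpret group "presented_group R" by (rule group_presented_group)
  have inv: "inv\<^bsub>presented_group R\<^esub> (pres_class R (gen x)) = pres_class R [(x, False)]" for x
  proof (rule inv_equality)
    have "pres_class R ([(x, False)] @ gen x) = pres_class R []"
      using pres_eq.cancel[of R "[]" x False "[]"] by (simp add: pres_class_eq_iff gen_def)
    then show "pres_class R [(x, False)] \<otimes>\<^bsub>presented_group R\<^esub> pres_class R (gen x)
        = \<one>\<^bsub>presented_group R\<^esub>"
      by (simp only: presented_group_mult) (simp add: presented_group_def)
  qed (simp_all add: pres_class_closed)
  obtain x e where l: "l = (x, e)" by (cases l)
  have "(if e then pres_class R (gen x) else inv\<^bsub>presented_group R\<^esub> (pres_class R (gen x)))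
      = pres_class R [l]"
    by (simp only: inv l) (simp add: gen_def)
  then have "word_eval (presented_group R) (\<lambda>x. pres_class R (gen x)) (l # w)
      = pres_class R [l] \<otimes>\<^bsub>presented_group R\<^esub> pres_class R w"
    using Cons by (simp add: word_eval_def l)
  also have "\<dots> = pres_class R (l # w)"
    by (simp only: presented_group_mult append_Cons append_Nil)
  finally show ?case .
qed

lemma presented_group_relation:
  "(p, q) \<in> R \<Longrightarrow> word_eval (presented_group R) (\<lambda>x. pres_class R (gen x)) p
     = word_eval (presented_group R) (\<lambda>x. pres_class R (gen x)) q"
  using pres_eq.rel[of p q R "[]" "[]"]
  by (simp add: word_eval_presented_group pres_class_eq_iff)

lemma carrier_presented_group:
  "carrier (presented_group R) =
     generate (presented_group R) (range (\<lambda>x. pres_class R (gen x)))"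
proof -
  interpret word_valuation "presented_group R" "\<lambda>x. pres_class R (gen x)"
    by (rule word_valuation_presented_group)
  have "carrier (presented_group R) = range (pres_class R)"
    by (simp add: presented_group_def)
  then show ?thesis
    using range_word_eval by (simp add: word_eval_presented_group)
qed


section \<open>Vectors and matrices modulo N\<close>

lemma vec_cong_iff:
  "vec_cong N x y \<longleftrightarrow> [x $ 1 = y $ 1] (mod int N) \<and> [x $ 2 = y $ 2] (mod int N)"
  by (simp add: vec_cong_def forall_2)

lemma vec_cong_refl [simp]: "vec_cong N x x"
  by (simp add: vec_cong_def)

lemma vec_cong_sym: "vec_cong N x y \<Longrightarrow> vec_cong N y x"
  by (simp add: vec_cong_def cong_sym)

lemma vec_cong_trans [trans]: "vec_cong N x y \<Longrightarrow> vec_cong N y w \<Longrightarrow> vec_cong N x w"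
  unfolding vec_cong_def by (metis cong_trans)

lemma vec_cong_add: "vec_cong N x y \<Longrightarrow> vec_cong N x' y' \<Longrightarrow> vec_cong N (x + x') (y + y')"
  by (simp add: vec_cong_def cong_add)

lemma vec_cong_uminus: "vec_cong N x y \<Longrightarrow> vec_cong N (- x) (- y)"
  by (simp add: vec_cong_def cong_minus_minus_iff)

lemma vec_cong_diff_0: "vec_cong N (x - y) 0 \<longleftrightarrow> vec_cong N x y"
  by (simp add: vec_cong_def cong_diff_iff_cong_0)

lemma vec_cong_uminus_0: "vec_cong N (- x) 0 \<longleftrightarrow> vec_cong N x 0"
  using vec_cong_uminus[of N x 0] vec_cong_uminus[of N "- x" 0] by auto

lemma mat_cong_refl [simp]: "mat_cong N X X"
  by (simp add: mat_cong_def)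

lemma mat_cong_sym: "mat_cong N X Y \<Longrightarrow> mat_cong N Y X"
  by (simp add: mat_cong_def cong_sym)

lemma mat_cong_trans [trans]: "mat_cong N X Y \<Longrightarrow> mat_cong N Y W \<Longrightarrow> mat_cong N X W"
  unfolding mat_cong_def by (metis cong_trans)

lemma mat_cong_add: "mat_cong N X Y \<Longrightarrow> mat_cong N X' Y' \<Longrightarrow> mat_cong N (X + X') (Y + Y')"
  by (simp add: mat_cong_def cong_add)

lemma mat_cong_mult: "mat_cong N X Y \<Longrightarrow> mat_cong N X' Y' \<Longrightarrow> mat_cong N (X ** X') (Y ** Y')"
  by (simp add: mat_cong_def matrix_matrix_mult_def cong_sum cong_mult)

lemma vec_cong_mult: "vec_cong N x y \<Longrightarrow> mat_cong N X Y \<Longrightarrow> vec_cong N (x v* X) (y v* Y)"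
  by (simp add: mat_cong_def vec_cong_def vector_matrix_mult_def cong_sum cong_mult)

text \<open>Tests matrix congruence on all row vectors. Identities between elements of the base of a group are
identities between such images, and this turns them into conditions on the matrices.\<close>

lemma mat_cong_eq_rows:
  assumes "\<And>v. vec_cong N (v v* X) (v v* Y)"
  shows "mat_cong N X Y"
proof -
  have "(axis i 1 v* W) $ j = W $ i $ j" for i j and W :: "int ^ 2 ^ 2"
    by (simp add: vector_matrix_mult_def axis_def if_distrib[of "\<lambda>x. x * _"] cong: if_cong)
  then show ?thesis
    using assms unfolding mat_cong_def vec_cong_def by metis
qed

lemma mat_cong_mat2:
  "mat_cong N (mat2 p q u v) (mat2 p' q' u' v') \<longleftrightarrow>
     [p = p'] (mod int N) \<and> [q = q'] (mod int N) \<and> [u = u'] (mod int N) \<and> [v = v'] (mod int N)"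
  by (auto simp: mat_cong_def mat2_def forall_2)

lemma mat2_mult:
  "mat2 p q u v ** mat2 p' q' u' v' =
     mat2 (p * p' + q * u') (p * q' + q * v') (u * p' + v * u') (u * q' + v * v')"
  by (simp add: vec_eq_iff forall_2 mat2_def matrix_matrix_mult_def sum_2)

lemma mat_1_eq_mat2: "mat 1 = mat2 1 0 0 1"
  by (simp add: vec_eq_iff forall_2 mat2_def mat_def)

lemma swap_square: "mat2 0 1 1 0 ** mat2 0 1 1 0 = mat 1"
  by (simp add: mat2_mult mat_1_eq_mat2)

lemma vec_eq_iff_2: "(x :: int ^ 2) = y \<longleftrightarrow> x $ 1 = y $ 1 \<and> x $ 2 = y $ 2"
  by (simp add: vec_eq_iff forall_2)

lemma vector_mult_mat2:
  "x v* mat2 p q u v = vector [x $ 1 * p + x $ 2 * u, x $ 1 * q + x $ 2 * v]"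
  by (simp add: vec_eq_iff_2 vector_matrix_mult_def sum_2 mat2_def)

lemma vector_matrix_mult_uminus: "(- x) v* X = - (x v* X)" for X :: "int ^ 2 ^ 2"
  by (simp add: vec_eq_iff_2 vector_matrix_mult_def sum_2)

lemma matrix_mult_add_distrib_right: "(X + Y) ** W = X ** W + Y ** W" for X :: "int ^ 2 ^ 2"
  by (simp add: matrix_matrix_mult_def vec_eq_iff ring_distribs sum.distrib)

lemma mat_power_add: "mat_power X (i + j) = mat_power X i ** mat_power X j"
  by (induction j) (simp_all add: matrix_mul_assoc)

lemma mat_power_mult: "mat_power X (i * j) = mat_power (mat_power X i) j"
proof (induction j)
  case (Suc j)
  have "mat_power X (i * Suc j) = mat_power X (i * j) ** mat_power X i"
    by (simp add: add.commute flip: mat_power_add)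
  then show ?case by (simp add: Suc)
qed simp

lemma mat_power_cong: "mat_cong N X Y \<Longrightarrow> mat_cong N (mat_power X j) (mat_power Y j)"
  by (induction j) (simp_all add: mat_cong_mult)

lemma mat_power_mat_1 [simp]: "mat_power (mat 1) j = mat 1"
  by (induction j) simp_all

lemma mat_power_cong_exponent:
  assumes "mat_cong N (mat_power X M) (mat 1)" and "[i = j] (mod M)"
  shows "mat_cong N (mat_power X i) (mat_power X j)"
proof -
  have red: "mat_cong N (mat_power X i) (mat_power X (i mod M))" for i
  proof -
    have "mat_power X i = mat_power (mat_power X M) (i div M) ** mat_power X (i mod M)"
      by (metis div_mult_mod_eq mat_power_add mat_power_mult mult.commute)
    also have "mat_cong N \<dots> (mat 1 ** mat_power X (i mod M))"
      using mat_power_cong[OF assms(1), of "i div M"] by (intro mat_cong_mult) simp_all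
    finally show ?thesis by simp
  qed
  show ?thesis
    using red[of i] red[of j] assms(2) mat_cong_sym mat_cong_trans unfolding cong_def by metis
qed

lemma S_mat_0 [simp]: "S_mat 0 X = 0"
  by (simp add: S_mat_def)

lemma S_mat_add: "S_mat (i + j) X = S_mat i X + S_mat j X ** mat_power X i"
proof (induction j)
  case (Suc j)
  have "S_mat (i + Suc j) X = S_mat (i + j) X + mat_power X (j + i)"
    by (simp add: S_mat_def add.commute)
  also have "\<dots> = S_mat i X + (S_mat j X + mat_power X j) ** mat_power X i"
    by (simp only: Suc mat_power_add matrix_mult_add_distrib_right add.assoc)
  finally show ?case by (simp add: S_mat_def)
qed (simp add: matrix_matrix_mult_def vec_eq_iff)

lemma S_mat_Suc: "S_mat (Suc j) X = mat 1 + S_mat j X ** X"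
  using S_mat_add[of 1 j X] by (simp add: S_mat_def)

lemma S_mat_mult: "S_mat (i * j) X = S_mat i X ** S_mat j (mat_power X i)"
proof (induction j)
  case 0
  show ?case by (simp add: matrix_matrix_mult_def vec_eq_iff)
next
  case (Suc j)
  have "S_mat (i * Suc j) X = S_mat (i * j) X + S_mat i X ** mat_power X (i * j)"
    using S_mat_add[of "i * j" i X] by (simp add: add.commute)
  also have "\<dots> = S_mat i X ** (S_mat j (mat_power X i) + mat_power (mat_power X i) j)"
    by (simp add: Suc mat_power_mult matrix_add_ldistrib)
  finally show ?case by (simp add: S_mat_def)
qed

lemma S_mat_cong: "mat_cong N X Y \<Longrightarrow> mat_cong N (S_mat j X) (S_mat j Y)"
  by (induction j) (simp_all add: S_mat_Suc mat_cong_mult mat_cong_add)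

text \<open>Commuting \<open>Y\<close> past \<open>X\<close> at the price of replacing \<open>X\<close> by \<open>W\<close> extends from \<open>X\<close> to its powers,
hence to their sum.\<close>

lemma S_mat_intertwine:
  assumes "mat_cong N (X ** Y) (Y ** W)"
  shows "mat_cong N (S_mat j X ** Y) (Y ** S_mat j W)"
proof (induction j)
  case (Suc j)
  have "S_mat (Suc j) X ** Y = Y + S_mat j X ** (X ** Y)"
    by (simp add: S_mat_Suc matrix_mult_add_distrib_right matrix_mul_assoc)
  also have "mat_cong N \<dots> (Y + S_mat j X ** (Y ** W))"
    by (intro mat_cong_add mat_cong_mult assms mat_cong_refl)
  also have "Y + S_mat j X ** (Y ** W) = Y + (S_mat j X ** Y) ** W"
    by (simp add: matrix_mul_assoc)
  also have "mat_cong N \<dots> (Y + (Y ** S_mat j W) ** W)"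
    by (intro mat_cong_add mat_cong_mult Suc mat_cong_refl)
  also have "\<dots> = Y ** S_mat (Suc j) W"
    by (simp add: S_mat_Suc matrix_add_ldistrib matrix_mul_assoc)
  finally show ?case .
qed (simp add: matrix_matrix_mult_def mat_cong_def)


section \<open>Triples of elements that satisfy the wreath relations\<close>

text \<open>Every commutation rule between the base and the other generators comes from this: a conjugation
relation for one generator extends to all its powers.\<close>

lemma (in group) intertwine_int_pow:
  assumes "x \<in> carrier G" "y \<in> carrier G" "g \<in> carrier G" and "x \<otimes> g = g \<otimes> y"
  shows "x [^] (i :: int) \<otimes> g = g \<otimes> y [^] i"
proof -
  have nat: "x [^] (n :: nat) \<otimes> g = g \<otimes> y [^] n"
    if "x \<in> carrier G" "y \<in> carrier G" "x \<otimes> g = g \<otimes> y" for n x y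
  proof (induction n)
    case (Suc n)
    have "x [^] Suc n \<otimes> g = x [^] n \<otimes> (x \<otimes> g)"
      using that assms(3) by (simp add: m_assoc)
    also have "\<dots> = (x [^] n \<otimes> g) \<otimes> y"
      using that assms(3) by (simp add: m_assoc)
    also have "\<dots> = g \<otimes> y [^] Suc n"
      using that assms(3) Suc by (simp add: m_assoc)
    finally show ?case .
  qed (use that assms(3) in simp)
  show ?thesis
  proof (cases i rule: int_cases2)
    case (nonneg n)
    then show ?thesis using nat assms by (simp add: int_pow_int)
  next
    case (nonpos n)
    have "inv x \<otimes> g = g \<otimes> inv y"
      using assms by (metis inv_closed inv_solve_left inv_solve_right m_assoc m_closed)
    then have "inv x [^] n \<otimes> g = g \<otimes> inv y [^] n"
      using assms by (intro nat) simp_all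
    then show ?thesis
      using assms nonpos by (simp add: int_pow_neg_int nat_pow_inv)
  qed
qed

text \<open>A concrete copy of the wreath relations inside an arbitrary group. The swap matrix is a parameter \<open>J\<close>
so that its name is shared with the extended group below.\<close>

locale wreath_triple = group G for G (structure) +
  fixes N :: nat and a b t J
  assumes closed [simp]: "a \<in> carrier G" "b \<in> carrier G" "t \<in> carrier G"
    and a_pow: "a [^] N = \<one>" and b_pow: "b [^] N = \<one>" and t_square: "t \<otimes> t = \<one>"
    and a_b_commute: "a \<otimes> b = b \<otimes> a"
    and a_conj_t: "inv t \<otimes> a \<otimes> t = b" and b_conj_t: "inv t \<otimes> b \<otimes> t = a"
    and J_def: "J = mat2 0 1 1 0"
begin

definition base :: "int ^ 2 \<Rightarrow> 'a" where
  "base v = a [^] (v $ 1) \<otimes> b [^] (v $ 2)"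

definition flip :: "bool \<Rightarrow> 'a" where
  "flip \<epsilon> = (if \<epsilon> then t else \<one>)"

lemma base_closed [simp]: "base v \<in> carrier G"
  by (simp add: base_def)

lemma flip_closed [simp]: "flip \<epsilon> \<in> carrier G"
  by (simp add: flip_def)

lemma a_b_pow_commute: "a [^] (i :: int) \<otimes> b [^] (j :: int) = b [^] j \<otimes> a [^] i"
proof -
  have "a [^] i \<otimes> b = b \<otimes> a [^] i"
    by (intro intertwine_int_pow closed a_b_commute)
  from intertwine_int_pow[OF _ _ _ this[symmetric], of j] show ?thesis by simp
qed

lemma base_0 [simp]: "base 0 = \<one>"
  by (simp add: base_def)

lemma base_add: "base (v + w) = base v \<otimes> base w"
proof -
  have "base v \<otimes> base w = a [^] (v $ 1) \<otimes> (b [^] (v $ 2) \<otimes> a [^] (w $ 1)) \<otimes> b [^] (w $ 2)"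
    by (simp add: base_def m_assoc)
  also have "b [^] (v $ 2) \<otimes> a [^] (w $ 1) = a [^] (w $ 1) \<otimes> b [^] (v $ 2)"
    by (rule a_b_pow_commute[symmetric])
  also have "a [^] (v $ 1) \<otimes> (a [^] (w $ 1) \<otimes> b [^] (v $ 2)) \<otimes> b [^] (w $ 2)
      = (a [^] (v $ 1) \<otimes> a [^] (w $ 1)) \<otimes> (b [^] (v $ 2) \<otimes> b [^] (w $ 2))"
    by (simp add: m_assoc)
  finally show ?thesis
    by (simp add: base_def int_pow_mult)
qed

lemma inv_base: "inv (base v) = base (- v)"
  by (rule inv_equality) (simp_all flip: base_add)

lemma base_cong:
  assumes "vec_cong N v w"
  shows "base v = base w"
proof -
  have "x [^] i = x [^] j" if "x \<in> carrier G" "x [^] N = \<one>" "[i = j] (mod int N)" for x and i j :: int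
  proof -
    have "int (ord x) dvd j - i"
      using that by (meson cong_iff_dvd_diff cong_sym dvd_trans int_dvd_int_iff pow_eq_id)
    then show ?thesis using that by (simp add: int_pow_eq)
  qed
  then have "a [^] (v $ 1) = a [^] (w $ 1)" "b [^] (v $ 2) = b [^] (w $ 2)"
    using assms a_pow b_pow by (meson closed vec_cong_iff)+
  then show ?thesis by (simp add: base_def)
qed

lemma a_eq_base: "a = base (vector [1, 0])" and b_eq_base: "b = base (vector [0, 1])"
  by (simp_all add: base_def)

lemma inv_t: "inv t = t"
  by (rule inv_equality) (simp_all add: t_square)

lemma base_t: "base v \<otimes> t = t \<otimes> base (v v* J)"
proof -
  have "a \<otimes> t = t \<otimes> b" "b \<otimes> t = t \<otimes> a"
    using a_conj_t b_conj_t inv_t by (metis closed inv_closed inv_solve_left m_assoc m_closed)+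
  then have a: "a [^] i \<otimes> t = t \<otimes> b [^] i" and b: "b [^] i \<otimes> t = t \<otimes> a [^] i" for i :: int
    by (simp_all add: intertwine_int_pow)
  have "base v \<otimes> t = a [^] (v $ 1) \<otimes> t \<otimes> a [^] (v $ 2)"
    by (simp add: base_def m_assoc b)
  also have "\<dots> = t \<otimes> (b [^] (v $ 1) \<otimes> a [^] (v $ 2))"
    by (simp add: a m_assoc)
  also have "b [^] (v $ 1) \<otimes> a [^] (v $ 2) = base (v v* J)"
    by (simp add: base_def J_def vector_mult_mat2 a_b_pow_commute)
  finally show ?thesis .
qed

lemma flip_base: "\<exists>w. flip \<epsilon> \<otimes> base v = base w \<otimes> flip \<epsilon>"
proof (cases \<epsilon>)
  case True
  have "base (v v* J) \<otimes> t = t \<otimes> base v"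
    by (simp add: base_t vector_matrix_mul_assoc J_def swap_square)
  with True show ?thesis
    by (intro exI[of _ "v v* J"]) (simp add: flip_def)
qed (auto simp: flip_def)

lemma flip_mult: "flip \<epsilon> \<otimes> flip \<epsilon>' = flip (\<epsilon> = (\<not> \<epsilon>'))"
  by (simp add: flip_def t_square)

lemma generate_base: "generate G {a, b} = range base"
proof -
  have "subgroup (range base) G"
  proof (rule subgroupI)
    show "inv x \<in> range base" if "x \<in> range base" for x
      using that by (auto simp: inv_base)
    show "x \<otimes> y \<in> range base" if "x \<in> range base" "y \<in> range base" for x y
      using that by (auto simp flip: base_add)
  qed auto
  moreover have "{a, b} \<subseteq> range base"
    using a_eq_base b_eq_base by blast
  moreover have "range base \<subseteq> K" if "subgroup K G" "{a, b} \<subseteq> K" for K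
    using that by (auto simp: base_def subgroup_int_pow_closed subgroup.m_closed)
  ultimately show ?thesis
    by (intro generateI[symmetric]) auto
qed

lemma generate_wreath: "generate G {a, b, t} = {base v \<otimes> flip \<epsilon> | v \<epsilon>. True}" (is "_ = ?H")
proof -
  have "subgroup ?H G"
  proof (rule subgroupI)
    show "?H \<noteq> {}" by blast
    show "inv x \<in> ?H" if "x \<in> ?H" for x
    proof -
      from that obtain v \<epsilon> where x: "x = base v \<otimes> flip \<epsilon>" by blast
      have "inv (flip \<epsilon>) = flip \<epsilon>"
        by (simp add: flip_def inv_t)
      then have "inv x = flip \<epsilon> \<otimes> base (- v)"
        by (simp add: x inv_mult_group inv_base)
      then show ?thesis using flip_base[of \<epsilon> "- v"] by auto
    qed
    show "x \<otimes> y \<in> ?H" if "x \<in> ?H" "y \<in> ?H" for x y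
    proof -
      from that obtain v \<epsilon> w \<epsilon>' where xy: "x = base v \<otimes> flip \<epsilon>" "y = base w \<otimes> flip \<epsilon>'" by blast
      obtain w' where w': "flip \<epsilon> \<otimes> base w = base w' \<otimes> flip \<epsilon>" using flip_base by blast
      have "x \<otimes> y = base v \<otimes> (flip \<epsilon> \<otimes> base w) \<otimes> flip \<epsilon>'"
        by (simp add: xy m_assoc)
      also have "\<dots> = base (v + w') \<otimes> flip (\<epsilon> = (\<not> \<epsilon>'))"
        by (simp add: w' base_add m_assoc flip: flip_mult)
      finally show ?thesis by blast
    qed
  qed auto
  moreover have "a = base (vector [1, 0]) \<otimes> flip False" "b = base (vector [0, 1]) \<otimes> flip False"
    "t = base 0 \<otimes> flip True"
    by (simp_all add: flip_def flip: a_eq_base b_eq_base)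
  then have "{a, b, t} \<subseteq> ?H" by blast
  moreover have "?H \<subseteq> K" if "subgroup K G" "{a, b, t} \<subseteq> K" for K
    using that
    by (auto simp: base_def flip_def subgroup_int_pow_closed subgroup.m_closed subgroup.one_closed)
  ultimately show ?thesis
    by (intro generateI[symmetric]) auto
qed

text \<open>Says that the triple generates as large a group as the relations permit: no element
\<open>a\<^sup>p b\<^sup>q t\<^sup>\<epsilon>\<close> is trivial except for the obvious ones.\<close>

definition faithful :: bool where
  "faithful \<longleftrightarrow> (\<forall>v \<epsilon>. base v \<otimes> flip \<epsilon> = \<one> \<longrightarrow> vec_cong N v 0 \<and> \<not> \<epsilon>)"

definition word_box :: "((int \<times> int) \<times> bool) set" where
  "word_box = ({0..<int N} \<times> {0..<int N}) \<times> UNIV"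

definition box_elem :: "(int \<times> int) \<times> bool \<Rightarrow> 'a" where
  "box_elem = (\<lambda>((p, q), \<epsilon>). base (vector [p, q]) \<otimes> flip \<epsilon>)"

lemma finite_word_box: "finite word_box" and card_word_box: "card word_box = 2 * N\<^sup>2"
  by (simp_all add: word_box_def card_cartesian_product power2_eq_square)

context
  assumes N_pos: "0 < N"
begin

lemma base_reduce: "base v = base (vector [v $ 1 mod int N, v $ 2 mod int N])"
  by (rule base_cong) (simp add: vec_cong_iff cong_def)

lemma generate_wreath_box: "generate G {a, b, t} = box_elem ` word_box"
proof -
  have "base v \<otimes> flip \<epsilon> \<in> box_elem ` word_box" for v \<epsilon>
    using N_pos
    by (intro image_eqI[of _ _ "((v $ 1 mod int N, v $ 2 mod int N), \<epsilon>)"])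
      (simp_all add: box_elem_def word_box_def flip: base_reduce)
  then show ?thesis
    by (auto simp: generate_wreath box_elem_def)
qed

lemma faithful_iff_inj_on: "faithful \<longleftrightarrow> inj_on box_elem word_box"
proof
  assume inj: "inj_on box_elem word_box"
  show faithful
    unfolding faithful_def
  proof (intro allI impI)
    fix v \<epsilon> assume "base v \<otimes> flip \<epsilon> = \<one>"
    then have "box_elem ((v $ 1 mod int N, v $ 2 mod int N), \<epsilon>) = box_elem ((0, 0), False)"
      using base_cong[of "vector [0, 0]" 0]
      by (simp add: box_elem_def flip_def vec_cong_iff flip: base_reduce)
    then have "((v $ 1 mod int N, v $ 2 mod int N), \<epsilon>) = ((0, 0), False)"
      by (rule inj_onD[OF inj]) (use N_pos in \<open>simp_all add: word_box_def\<close>)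
    then show "vec_cong N v 0 \<and> \<not> \<epsilon>"
      by (simp add: vec_cong_iff cong_def)
  qed
next
  assume faithful: faithful
  show "inj_on box_elem word_box"
  proof (rule inj_onI, clarsimp simp: word_box_def box_elem_def)
    fix p q \<epsilon> p' q' \<epsilon>'
    assume ranges: "0 \<le> p" "p < int N" "0 \<le> q" "q < int N" "0 \<le> p'" "p' < int N" "0 \<le> q'" "q' < int N"
      and eq: "base (vector [p, q]) \<otimes> flip \<epsilon> = base (vector [p', q']) \<otimes> flip \<epsilon>'"
    define v w :: "int ^ 2" where "v = vector [p, q]" and "w = vector [p', q']"
    have "base (- w + v) \<otimes> flip (\<epsilon> = (\<not> \<epsilon>')) = inv (base w) \<otimes> (base v \<otimes> flip \<epsilon>) \<otimes> flip \<epsilon>'"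
      by (simp only: base_add inv_base flip_mult[symmetric])
        (simp add: m_assoc flip: inv_base)
    also have "\<dots> = inv (base w) \<otimes> base w \<otimes> (flip \<epsilon>' \<otimes> flip \<epsilon>')"
      using eq unfolding v_def[symmetric] w_def[symmetric]
      by (simp only: m_assoc inv_closed base_closed flip_closed m_closed)
    also have "\<dots> = \<one>"
      by (simp add: flip_mult) (simp add: flip_def)
    finally have "vec_cong N (- w + v) 0 \<and> \<not> (\<epsilon> = (\<not> \<epsilon>'))"
      using faithful unfolding faithful_def by blast
    then have "vec_cong N v w" "\<epsilon> = \<epsilon>'"
      using vec_cong_diff_0[of N v w] by simp_all
    then show "p = p' \<and> q = q' \<and> \<epsilon> = \<epsilon>'"
      using ranges by (simp add: vec_cong_iff v_def w_def cong_less_imp_eq_int)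
  qed
qed

text \<open>The generated group is the image of the \<open>2 N\<^sup>2\<close> reduced exponents, so that injectivity on them is
visible from the cardinality alone. This makes \<open>faithful\<close> invariant under isomorphism.\<close>

lemma faithful_iff_card: "faithful \<longleftrightarrow> card (generate G {a, b, t}) = 2 * N\<^sup>2"
  using inj_on_iff_eq_card[OF finite_word_box, of box_elem]
  by (simp add: faithful_iff_inj_on generate_wreath_box card_word_box)

end

end


section \<open>Recognising the wreathed and the cyclic factor\<close>

lemma (in word_valuation) wreath_relations_hold_iff:
  "(\<forall>(p, q) \<in> wreath_relations N (gen x) (gen y) (gen w). word_eval G f p = word_eval G f q)
     \<longleftrightarrow> wreath_triple G N (f x) (f y) (f w) (mat2 0 1 1 0)"
proof -
  have comm: "inv a \<otimes> inv b \<otimes> a \<otimes> b = \<one> \<longleftrightarrow> a \<otimes> b = b \<otimes> a"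
    if "a \<in> carrier G" "b \<in> carrier G" for a b
  proof -
    have "inv a \<otimes> inv b \<otimes> a \<otimes> b = inv (b \<otimes> a) \<otimes> (a \<otimes> b)"
      using that by (simp add: inv_mult_group m_assoc)
    then show ?thesis
      using that by (metis inv_closed inv_equality inv_inv l_inv m_closed)
  qed
  have sq: "a [^] (2 :: int) = a \<otimes> a" if "a \<in> carrier G" for a
    using int_pow_mult[OF that, of 1 1] that by simp
  show ?thesis
    unfolding wreath_relations_def wreath_triple_def wreath_triple_axioms_def
    using group_axioms
    by (auto simp: word_eval_simps int_pow_int comm sq)
qed

lemma UNIV_wreath_gen: "UNIV = {Wa, Wb, Wt}"
proof -
  have "x \<in> {Wa, Wb, Wt}" for x by (cases x) simp_all
  then show ?thesis by blast
qed

lemma wreathed_group_triple: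
  defines "R \<equiv> (\<lambda>n. wreath_relations (2 ^ n) (gen Wa) (gen Wb) (gen Wt))"
  shows "wreath_triple (wreathed_group n) (2 ^ n) (pres_class (R n) (gen Wa))
    (pres_class (R n) (gen Wb)) (pres_class (R n) (gen Wt)) (mat2 0 1 1 0)"
    and "carrier (wreathed_group n) = generate (wreathed_group n)
      {pres_class (R n) (gen Wa), pres_class (R n) (gen Wb), pres_class (R n) (gen Wt)}"
proof -
  interpret word_valuation "presented_group (R n)" "\<lambda>x. pres_class (R n) (gen x)"
    by (rule word_valuation_presented_group)
  show "wreath_triple (wreathed_group n) (2 ^ n) (pres_class (R n) (gen Wa))
    (pres_class (R n) (gen Wb)) (pres_class (R n) (gen Wt)) (mat2 0 1 1 0)"
    using wreath_relations_hold_iff[of "2 ^ n" Wa Wb Wt] presented_group_relation[of _ _ "R n"]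
    unfolding wreathed_group_def by (auto simp: R_def)
  have "range (\<lambda>x. pres_class (R n) (gen x))
      = {pres_class (R n) (gen Wa), pres_class (R n) (gen Wb), pres_class (R n) (gen Wt)}"
    by (simp add: UNIV_wreath_gen)
  then show "carrier (wreathed_group n) = generate (wreathed_group n)
      {pres_class (R n) (gen Wa), pres_class (R n) (gen Wb), pres_class (R n) (gen Wt)}"
    using carrier_presented_group[of "R n"] by (simp add: wreathed_group_def R_def)
qed

lemma finite_wreathed_group: "finite (carrier (wreathed_group n))"
  and card_wreathed_group_le: "card (carrier (wreathed_group n)) \<le> 2 * (2 ^ n)\<^sup>2"
proof -
  interpret W: wreath_triple "wreathed_group n" "2 ^ n"
    "pres_class (wreath_relations (2 ^ n) (gen Wa) (gen Wb) (gen Wt)) (gen Wa)"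
    "pres_class (wreath_relations (2 ^ n) (gen Wa) (gen Wb) (gen Wt)) (gen Wb)"
    "pres_class (wreath_relations (2 ^ n) (gen Wa) (gen Wb) (gen Wt)) (gen Wt)" "mat2 0 1 1 0"
    by (rule wreathed_group_triple)
  have eq: "carrier (wreathed_group n) = W.box_elem ` W.word_box"
    by (simp only: wreathed_group_triple(2) W.generate_wreath_box zero_less_power zero_less_numeral)
  show "finite (carrier (wreathed_group n))"
    using W.finite_word_box by (simp only: eq finite_imageI)
  show "card (carrier (wreathed_group n)) \<le> 2 * (2 ^ n)\<^sup>2"
    using card_image_le[OF W.finite_word_box, of W.box_elem] by (simp only: eq W.card_word_box)
qed

lemma (in wreath_triple) wreathed_group_onto:
  assumes "N = 2 ^ n"
  obtains h where "h \<in> hom (wreathed_group n) G"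
    and "h ` carrier (wreathed_group n) = generate G {a, b, t}"
proof -
  define f where "f x = (case x of Wa \<Rightarrow> a | Wb \<Rightarrow> b | Wt \<Rightarrow> t)" for x
  interpret word_valuation G f
    by unfold_locales (simp add: f_def split: wreath_gen.split)
  let ?R = "wreath_relations (2 ^ n) (gen Wa) (gen Wb) (gen Wt)"
  have "wreath_triple G (2 ^ n) (f Wa) (f Wb) (f Wt) (mat2 0 1 1 0)"
    using wreath_triple_axioms assms J_def by (simp add: f_def)
  then have "word_eval G f p = word_eval G f q" if "(p, q) \<in> ?R" for p q
    using that wreath_relations_hold_iff[of "2 ^ n" Wa Wb Wt] by blast
  then obtain h where h: "h \<in> hom (presented_group ?R) G"
      "\<And>w. h (pres_class ?R w) = word_eval G f w"
    using presented_group_universal by metis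
  have "range f = {a, b, t}"
    by (simp add: UNIV_wreath_gen f_def)
  moreover have "h ` carrier (presented_group ?R) = range (word_eval G f)"
    by (auto simp: presented_group_def h(2) image_image)
  ultimately have "h ` carrier (wreathed_group n) = generate G {a, b, t}"
    by (simp add: wreathed_group_def range_word_eval)
  with h(1) that show ?thesis by (simp add: wreathed_group_def)
qed

text \<open>A faithful triple in any group bounds the order of the presented group from below, because the
presented group maps onto what the triple generates; its own normal forms bound the order from above.\<close>

lemma (in wreath_triple) faithful_imp_card_wreathed_group:
  assumes "N = 2 ^ n" and faithful
  shows "card (carrier (wreathed_group n)) = 2 * (2 ^ n)\<^sup>2"
proof -
  obtain h where "h ` carrier (wreathed_group n) = generate G {a, b, t}"
    using wreathed_group_onto[OF assms(1)] by blast
  then have "card (generate G {a, b, t}) \<le> card (carrier (wreathed_group n))"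
    by (metis card_image_le finite_wreathed_group)
  then show ?thesis
    using assms faithful_iff_card card_wreathed_group_le[of n] by simp
qed

text \<open>Both directions are a comparison of orders: the canonical map from the wreathed group onto the
generated subgroup is a bijection iff the two finite groups have the same order.\<close>

lemma (in wreath_triple) iso_wreathed_group_iff_faithful:
  assumes N: "N = 2 ^ n" and card: "card (carrier (wreathed_group n)) = 2 * (2 ^ n)\<^sup>2"
  shows "G\<lparr>carrier := generate G {a, b, t}\<rparr> \<cong> wreathed_group n \<longleftrightarrow> faithful"
proof
  assume "G\<lparr>carrier := generate G {a, b, t}\<rparr> \<cong> wreathed_group n"
  then have "card (generate G {a, b, t}) = 2 * N\<^sup>2"
    using iso_same_card card N by fastforce
  then show faithful
    using faithful_iff_card N by simp
next
  assume faithful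
  then have card_H: "card (generate G {a, b, t}) = 2 * N\<^sup>2"
    using faithful_iff_card N by simp
  obtain h where h: "h \<in> hom (wreathed_group n) G"
      "h ` carrier (wreathed_group n) = generate G {a, b, t}"
    using wreathed_group_onto[OF N] by blast
  have "inj_on h (carrier (wreathed_group n))"
    using finite_wreathed_group card card_H N h(2) by (intro eq_card_imp_inj_on) simp_all
  then have "h \<in> iso (wreathed_group n) (G\<lparr>carrier := generate G {a, b, t}\<rparr>)"
    using h by (auto simp: iso_def bij_betw_def hom_def)
  moreover have "group (wreathed_group n)"
    unfolding wreathed_group_def by (rule group_presented_group)
  ultimately show "G\<lparr>carrier := generate G {a, b, t}\<rparr> \<cong> wreathed_group n"
    using group.iso_sym is_isoI by blast
qed

lemma (in group) iso_integer_mod_group_iff_ord: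
  assumes z: "z \<in> carrier G" and M: "0 < M"
  shows "G\<lparr>carrier := generate G {z}\<rparr> \<cong> integer_mod_group M \<longleftrightarrow> ord z = M"
proof
  assume "G\<lparr>carrier := generate G {z}\<rparr> \<cong> integer_mod_group M"
  then have "card (generate G {z}) = M"
    using iso_same_card M by (fastforce simp: carrier_integer_mod_group)
  then show "ord z = M"
    using generate_pow_card[OF z] by simp
next
  assume ord: "ord z = M"
  let ?f = "\<lambda>i :: int. z [^] i"
  have "?f ` {0..<int M} = generate G {z}"
  proof -
    have "z [^] i = z [^] (i mod int M)" for i :: int
      using int_pow_eq[OF z] ord by (simp add: mod_eq_dvd_iff[symmetric])
    then show ?thesis
      using M by (fastforce simp: generate_pow[OF z] image_def)
  qed
  moreover have "inj_on ?f {0..<int M}"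
  proof (rule inj_onI)
    fix i j assume *: "i \<in> {0..<int M}" "j \<in> {0..<int M}" "z [^] i = z [^] j"
    then have "[j = i] (mod int M)"
      using int_pow_eq[OF z] ord by (simp add: cong_iff_dvd_diff)
    with * show "i = j"
      using cong_less_imp_eq_int[of j "int M" i] by simp
  qed
  moreover have "z [^] ((i + j) mod int M) = z [^] i \<otimes> z [^] j" for i j :: int
    using int_pow_eq[OF z] ord z by (simp add: mod_eq_dvd_iff[symmetric] flip: int_pow_mult)
  ultimately have "?f \<in> iso (integer_mod_group M) (G\<lparr>carrier := generate G {z}\<rparr>)"
    using M by (auto simp: iso_def bij_betw_def hom_def carrier_integer_mod_group)
  then show "G\<lparr>carrier := generate G {z}\<rparr> \<cong> integer_mod_group M"
    using group.iso_sym group_integer_mod_group is_isoI by blast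
qed


section \<open>Normal forms in the extended group\<close>

text \<open>Here \<open>e\<close> is a non-negative exponent for \<open>z\<^bsup>-2c\<^esup>\<close>, and \<open>u\<close> is the vector for which the relation
between \<open>t\<close> and \<open>z\<close> takes the form \<open>z\<^sup>t = z\<^sup>k u\<close>.\<close>

locale ext_params =
  fixes N M k e :: nat and \<alpha> \<beta> \<gamma> \<delta> r s c :: int and Z J :: "int ^ 2 ^ 2" and u :: "int ^ 2"
  assumes M_pos: "0 < M"
    and J_mat: "J = mat2 0 1 1 0" and Z_def: "Z = mat2 \<alpha> \<beta> \<gamma> \<delta>"
    and k_cong: "[int k = 1 - 2 * c] (mod int M)" and e_cong: "[int e = - 2 * c] (mod int M)"
    and u_def: "u = - (vector [r, s] v* mat_power Z e)"
begin

text \<open>The five conditions without coordinates: \<open>Z J = J Z\<^sup>k\<close> stands for \<open>Z\<^sup>k = J Z J\<close>; the fourth and the fifth are expressed through \<open>u\<close>.\<close>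

definition consistent :: bool where
  "consistent \<longleftrightarrow>
     mat_cong N (mat_power Z M) (mat 1) \<and>
     mat_cong N (Z ** J) (J ** mat_power Z k) \<and>
     [k * k = 1] (mod M) \<and>
     vec_cong N (u v* (S_mat k (mat_power Z k) + J)) 0 \<and>
     vec_cong N (u v* S_mat M (mat_power Z k)) 0"

lemma k_e_cong: "[1 + e = k] (mod M)"
proof -
  have "[1 + int e = 1 + - 2 * c] (mod int M)"
    by (intro cong_add cong_refl e_cong)
  then have "[int (1 + e) = int k] (mod int M)"
    using k_cong by (simp add: cong_def)
  then show ?thesis by (simp only: cong_int_iff)
qed

lemma consistent_iff:
  defines "\<tau> \<equiv> \<alpha> + \<delta>" and "\<nu> \<equiv> \<alpha> * \<delta> - \<beta> * \<gamma>"
  shows "consistent \<longleftrightarrow>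
     (([A_seq \<tau> \<nu> M * \<alpha> + B_seq \<tau> \<nu> M = 1] (mod int N) \<and>
       [A_seq \<tau> \<nu> M * \<beta> = 0] (mod int N) \<and>
       [A_seq \<tau> \<nu> M * \<gamma> = 0] (mod int N) \<and>
       [A_seq \<tau> \<nu> M * \<delta> + B_seq \<tau> \<nu> M = 1] (mod int N)) \<and>
      ([A_seq \<tau> \<nu> k * \<alpha> + B_seq \<tau> \<nu> k = \<delta>] (mod int N) \<and>
       [A_seq \<tau> \<nu> k * \<beta> = \<gamma>] (mod int N) \<and>
       [A_seq \<tau> \<nu> k * \<gamma> = \<beta>] (mod int N) \<and>
       [A_seq \<tau> \<nu> k * \<delta> + B_seq \<tau> \<nu> k = \<alpha>] (mod int N)) \<and>
      [(1 - 2 * c)\<^sup>2 = 1] (mod int M) \<and>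
      vec_cong N (vector [r, s] v* (mat_power Z e ** (S_mat k (mat_power Z k) + J))) 0 \<and>
      vec_cong N (vector [r, s] v* (mat_power Z e ** S_mat M (mat_power Z k))) 0)"
proof -
  have neg: "vec_cong N (u v* X) 0 \<longleftrightarrow> vec_cong N (vector [r, s] v* (mat_power Z e ** X)) 0" for X
    by (simp add: u_def vector_matrix_mult_uminus vec_cong_uminus_0 vector_matrix_mul_assoc)
  have Z: "mat_power Z j = mat2 (A_seq \<tau> \<nu> j * \<alpha> + B_seq \<tau> \<nu> j) (A_seq \<tau> \<nu> j * \<beta>)
         (A_seq \<tau> \<nu> j * \<gamma>) (A_seq \<tau> \<nu> j * \<delta> + B_seq \<tau> \<nu> j)" for j
    by (simp add: Z_def \<tau>_def \<nu>_def mat_power_A_B)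
  have k: "[(1 - 2 * c)\<^sup>2 = 1] (mod int M) \<longleftrightarrow> [k * k = 1] (mod M)"
  proof -
    have "[int k * int k = (1 - 2 * c)\<^sup>2] (mod int M)"
      unfolding power2_eq_square by (intro cong_mult k_cong)
    then have "[(1 - 2 * c)\<^sup>2 = 1] (mod int M) \<longleftrightarrow> [int (k * k) = int 1] (mod int M)"
      by (simp add: cong_def)
    then show ?thesis by (simp only: cong_int_iff)
  qed
  have "mat_cong N (mat_power Z M) (mat 1) \<longleftrightarrow>
      [A_seq \<tau> \<nu> M * \<alpha> + B_seq \<tau> \<nu> M = 1] (mod int N) \<and>
      [A_seq \<tau> \<nu> M * \<beta> = 0] (mod int N) \<and>
      [A_seq \<tau> \<nu> M * \<gamma> = 0] (mod int N) \<and>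
      [A_seq \<tau> \<nu> M * \<delta> + B_seq \<tau> \<nu> M = 1] (mod int N)"
    by (simp only: Z mat_1_eq_mat2 mat_cong_mat2)
  moreover have "mat_cong N (Z ** J) (J ** mat_power Z k) \<longleftrightarrow>
      [A_seq \<tau> \<nu> k * \<alpha> + B_seq \<tau> \<nu> k = \<delta>] (mod int N) \<and>
      [A_seq \<tau> \<nu> k * \<beta> = \<gamma>] (mod int N) \<and>
      [A_seq \<tau> \<nu> k * \<gamma> = \<beta>] (mod int N) \<and>
      [A_seq \<tau> \<nu> k * \<delta> + B_seq \<tau> \<nu> k = \<alpha>] (mod int N)"
    unfolding Z by (auto simp: Z_def J_mat mat2_mult mat_cong_mat2 cong_sym_eq)
  ultimately show ?thesis
    unfolding consistent_def neg k by blast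
qed

end


locale ext_quadruple = ext_params + wreath_triple G N a b t J for G (structure) and a b t +
  fixes z
  assumes z_closed [simp]: "z \<in> carrier G" and z_pow: "z [^] M = \<one>"
    and a_conj_z: "inv z \<otimes> a \<otimes> z = a [^] \<alpha> \<otimes> b [^] \<beta>"
    and b_conj_z: "inv z \<otimes> b \<otimes> z = a [^] \<gamma> \<otimes> b [^] \<delta>"
    and t_conj_z: "inv z \<otimes> t \<otimes> z = t \<otimes> z [^] (2 * c) \<otimes> a [^] r \<otimes> b [^] s"
begin

lemma z_int_pow_cong:
  assumes "[i = j] (mod int M)"
  shows "z [^] i = z [^] j"
proof -
  have "int (ord z) dvd j - i"
    using assms z_pow by (meson cong_iff_dvd_diff cong_sym dvd_trans int_dvd_int_iff pow_eq_id z_closed)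
  then show ?thesis by (simp add: int_pow_eq)
qed

lemma z_pow_cong:
  assumes "[i = j] (mod M)"
  shows "z [^] i = z [^] j"
  using z_int_pow_cong[of "int i" "int j"] assms by (simp add: cong_int_iff int_pow_int)

lemma base_z: "base v \<otimes> z = z \<otimes> base (v v* Z)"
proof -
  define p q :: "int ^ 2" where "p = vector [\<alpha>, \<beta>]" and "q = vector [\<gamma>, \<delta>]"
  have pow: "base w [^] i = base (i *s w)" for w and i :: int
  proof -
    have "base w [^] i = (a [^] (w $ 1)) [^] i \<otimes> (b [^] (w $ 2)) [^] i"
      unfolding base_def by (intro int_pow_mult_distrib a_b_pow_commute) simp_all
    then show ?thesis
      by (simp add: base_def int_pow_pow mult.commute)
  qed
  have move: "x \<otimes> z = z \<otimes> y" if "inv z \<otimes> x \<otimes> z = y" "x \<in> carrier G" for x y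
    using that by (metis inv_closed inv_solve_left m_assoc m_closed z_closed)
  have a: "a \<otimes> z = z \<otimes> base p" and b: "b \<otimes> z = z \<otimes> base q"
    using move a_conj_z b_conj_z by (simp_all add: base_def p_def q_def)
  have "base v \<otimes> z = a [^] (v $ 1) \<otimes> (b [^] (v $ 2) \<otimes> z)"
    by (simp add: base_def m_assoc)
  also have "\<dots> = (a [^] (v $ 1) \<otimes> z) \<otimes> base (v $ 2 *s q)"
    by (simp add: intertwine_int_pow[OF _ _ _ b] m_assoc pow)
  also have "\<dots> = z \<otimes> base (v $ 1 *s p + v $ 2 *s q)"
    by (simp add: intertwine_int_pow[OF _ _ _ a] m_assoc pow base_add)
  also have "v $ 1 *s p + v $ 2 *s q = v v* Z"
    by (simp add: Z_def vector_mult_mat2 p_def q_def vec_eq_iff_2)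
  finally show ?thesis .
qed

lemma base_z_pow: "base v \<otimes> z [^] (j :: nat) = z [^] j \<otimes> base (v v* mat_power Z j)"
proof (induction j)
  case (Suc j)
  have "base v \<otimes> z [^] Suc j = (base v \<otimes> z [^] j) \<otimes> z"
    by (simp add: m_assoc)
  also have "\<dots> = z [^] j \<otimes> (base (v v* mat_power Z j) \<otimes> z)"
    by (simp add: Suc m_assoc)
  also have "\<dots> = z [^] Suc j \<otimes> base (v v* mat_power Z (Suc j))"
    by (simp add: base_z m_assoc vector_matrix_mul_assoc)
  finally show ?case .
qed simp

text \<open>Moving a power of \<open>z\<close> to the right past the base calls for the action of the inverse of \<open>z\<close>, which
is that of \<open>Z\<^bsup>M-1\<^esup>\<close> because \<open>z\<^sup>M = 1\<close>.\<close>

lemma z_pow_base: "\<exists>w. z [^] (j :: nat) \<otimes> base v = base w \<otimes> z [^] j"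
proof -
  have "(M - 1) * j + j = M * j"
    using M_pos by (metis Suc_pred add.commute mult_Suc One_nat_def)
  then have "mat_power Z ((M - 1) * j) ** mat_power Z j = mat_power Z (M * j)"
    by (simp flip: mat_power_add)
  then have "base (v v* mat_power Z ((M - 1) * j)) \<otimes> z [^] j = z [^] j \<otimes> base (v v* mat_power Z (M * j))"
    by (simp add: base_z_pow vector_matrix_mul_assoc)
  also have "base (v v* mat_power Z (M * j)) = base v"
  proof -
    have "z [^] (M * j) = \<one>"
      using z_pow by (simp flip: nat_pow_pow)
    then show ?thesis using base_z_pow[of v "M * j"] by simp
  qed
  finally show ?thesis by metis
qed

text \<open>The relation \<open>t\<^sup>z = t z\<^bsup>2c\<^esup> a\<^sup>r b\<^sup>s\<close> solved for \<open>z t\<close>; moving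
\<open>z\<^bsup>-2c\<^esup>\<close> to the left past the base turns \<open>- (r, s)\<close> into \<open>u\<close>.\<close>

lemma z_t: "z \<otimes> t = t \<otimes> z [^] k \<otimes> base u"
proof -
  let ?rs = "vector [r, s] :: int ^ 2"
  \<comment> \<open>Multiply \<open>t z = z t z\<^bsup>2c\<^esup> a\<^sup>r b\<^sup>s\<close> on the right by the inverse of \<open>z\<^bsup>2c\<^esup> a\<^sup>r b\<^sup>s\<close>.\<close>
  have "t \<otimes> z = z \<otimes> (inv z \<otimes> t \<otimes> z)"
    by (simp add: m_assoc[symmetric])
  then have "t \<otimes> z = z \<otimes> t \<otimes> z [^] (2 * c) \<otimes> base ?rs"
    by (simp add: t_conj_z base_def m_assoc)
  then have "z \<otimes> t = t \<otimes> z \<otimes> base (- ?rs) \<otimes> z [^] (- (2 * c))"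
    by (simp add: m_assoc int_pow_neg flip: inv_base)
  also have "z [^] (- (2 * c)) = z [^] int e"
    using e_cong by (intro z_int_pow_cong) (simp add: cong_sym)
  also have "t \<otimes> z \<otimes> base (- ?rs) \<otimes> z [^] int e = t \<otimes> (z \<otimes> z [^] e) \<otimes> base u"
    by (simp add: int_pow_int m_assoc base_z_pow u_def vector_matrix_mult_uminus)
  also have "z \<otimes> z [^] e = z [^] (1 + e)"
    using nat_pow_mult[of z 1 e] by simp
  also have "\<dots> = z [^] k"
    by (intro z_pow_cong k_e_cong)
  finally show ?thesis .
qed

text \<open>This is \<open>(z\<^sup>k u)\<^sup>j = z\<^bsup>k j\<^esup> u S\<^sub>j(Z\<^sup>k)\<close>: collecting the powers of \<open>z\<close> on the left moves each
factor \<open>u\<close> past the copies of \<open>z\<^sup>k\<close> to its right, of which there are \<open>0, \<dots>, j - 1\<close>.\<close>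

lemma z_pow_t:
  "z [^] (j :: nat) \<otimes> t = t \<otimes> z [^] (k * j) \<otimes> base (u v* S_mat j (mat_power Z k))"
proof (induction j)
  case (Suc j)
  have "z [^] Suc j \<otimes> t = z [^] j \<otimes> t \<otimes> (z [^] k \<otimes> base u)"
    by (simp add: m_assoc z_t)
  also have "\<dots> = t \<otimes> z [^] (k * j) \<otimes> (base (u v* S_mat j (mat_power Z k)) \<otimes> z [^] k) \<otimes> base u"
    by (simp add: Suc m_assoc)
  also have "\<dots> = t \<otimes> (z [^] (k * j) \<otimes> z [^] k)
      \<otimes> (base (u v* S_mat j (mat_power Z k) v* mat_power Z k) \<otimes> base u)"
    by (simp add: base_z_pow m_assoc)
  also have "\<dots> = t \<otimes> z [^] (k * Suc j) \<otimes> base (u v* S_mat (Suc j) (mat_power Z k))"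
    by (simp add: nat_pow_mult add.commute S_mat_Suc vector_matrix_mul_assoc
        vector_matrix_mult_add_rdistrib flip: base_add)
  finally show ?case .
qed simp

definition normal_form :: "bool \<Rightarrow> nat \<Rightarrow> int ^ 2 \<Rightarrow> 'a" where
  "normal_form \<epsilon> j w = flip \<epsilon> \<otimes> z [^] j \<otimes> base w"

lemma normal_form_closed [simp]: "normal_form \<epsilon> j w \<in> carrier G"
  by (simp add: normal_form_def)

lemma normal_form_base: "normal_form \<epsilon> j w \<otimes> base v = normal_form \<epsilon> j (w + v)"
  by (simp add: normal_form_def base_add m_assoc)

lemma normal_form_z_pow:
  "normal_form \<epsilon> j w \<otimes> z [^] (i :: nat) = normal_form \<epsilon> (j + i) (w v* mat_power Z i)"
proof -
  have "normal_form \<epsilon> j w \<otimes> z [^] i = flip \<epsilon> \<otimes> z [^] j \<otimes> (base w \<otimes> z [^] i)"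
    by (simp add: normal_form_def m_assoc)
  also have "\<dots> = flip \<epsilon> \<otimes> (z [^] j \<otimes> z [^] i) \<otimes> base (w v* mat_power Z i)"
    by (simp add: base_z_pow m_assoc)
  finally show ?thesis by (simp add: normal_form_def nat_pow_mult)
qed

lemma normal_form_t:
  "normal_form \<epsilon> j w \<otimes> t
     = normal_form (\<not> \<epsilon>) (k * j) (u v* S_mat j (mat_power Z k) + w v* J)"
proof -
  have "normal_form \<epsilon> j w \<otimes> t = flip \<epsilon> \<otimes> (z [^] j \<otimes> t) \<otimes> base (w v* J)"
    by (simp add: normal_form_def base_t m_assoc)
  also have "\<dots> = (flip \<epsilon> \<otimes> flip True) \<otimes> z [^] (k * j)
      \<otimes> base (u v* S_mat j (mat_power Z k) + w v* J)"
    by (simp add: z_pow_t base_add m_assoc) (simp add: flip_def)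
  finally show ?thesis by (simp add: normal_form_def flip_mult)
qed

lemma normal_form_flip: "\<exists>\<epsilon>'' j' w'. normal_form \<epsilon> j w \<otimes> flip \<epsilon>' = normal_form \<epsilon>'' j' w'"
  using normal_form_t by (cases \<epsilon>') (auto simp: flip_def)

lemma normal_form_mult: "\<exists>\<epsilon>'' j'' w''. normal_form \<epsilon> j w \<otimes> normal_form \<epsilon>' j' w' = normal_form \<epsilon>'' j'' w''"
proof -
  have "normal_form \<epsilon> j w \<otimes> normal_form \<epsilon>' j' w'
      = normal_form \<epsilon> j w \<otimes> flip \<epsilon>' \<otimes> z [^] j' \<otimes> base w'"
    unfolding normal_form_def[of \<epsilon>' j' w'] by (simp add: m_assoc)
  then show ?thesis
    using normal_form_flip[of \<epsilon> j w \<epsilon>'] by (metis normal_form_base normal_form_z_pow)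
qed

lemma generate_normal_form: "generate G {a, b, t, z} = {normal_form \<epsilon> j w | \<epsilon> j w. True}"
  (is "_ = ?P")
proof -
  have one: "normal_form False 0 0 = \<one>"
    by (simp add: normal_form_def flip_def)
  have "subgroup ?P G"
  proof (rule subgroupI)
    show "?P \<noteq> {}" by blast
    show "x \<otimes> y \<in> ?P" if "x \<in> ?P" "y \<in> ?P" for x y
      using that normal_form_mult by blast
    show "inv x \<in> ?P" if x_in: "x \<in> ?P" for x
    proof -
      from x_in obtain \<epsilon> j w where x: "x = normal_form \<epsilon> j w" by blast
      have "z [^] ((M - 1) * j) \<otimes> z [^] j = \<one>"
      proof -
        have "(M - 1) * j + j = M * j"
          using M_pos by (metis Suc_pred add.commute mult_Suc One_nat_def)
        moreover have "z [^] (M * j) = \<one>"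
          using z_pow by (simp flip: nat_pow_pow)
        ultimately show ?thesis
          by (simp only: nat_pow_mult z_closed)
      qed
      then have inv_z: "inv (z [^] j) = z [^] ((M - 1) * j)"
        by (intro inv_equality) simp_all
      have inv_flip: "inv (flip \<epsilon>) = flip \<epsilon>"
        by (simp add: flip_def inv_t)
      have "inv x = normal_form False 0 (- w) \<otimes> normal_form False ((M - 1) * j) 0 \<otimes> flip \<epsilon>"
        by (simp add: x normal_form_def inv_mult_group inv_z inv_flip inv_base m_assoc)
          (simp add: flip_def)
      moreover obtain \<epsilon>' j' w' where
        "normal_form False 0 (- w) \<otimes> normal_form False ((M - 1) * j) 0 = normal_form \<epsilon>' j' w'"
        using normal_form_mult by blast
      moreover obtain \<epsilon>'' j'' w'' where
        "normal_form \<epsilon>' j' w' \<otimes> flip \<epsilon> = normal_form \<epsilon>'' j'' w''"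
        using normal_form_flip by blast
      ultimately have "inv x = normal_form \<epsilon>'' j'' w''" by simp
      then show ?thesis by blast
    qed
  qed auto
  moreover have "a = normal_form False 0 (vector [1, 0])" "b = normal_form False 0 (vector [0, 1])"
    "t = normal_form True 0 0" "z = normal_form False 1 0"
    by (simp_all add: normal_form_def flip_def flip: a_eq_base b_eq_base)
  then have "{a, b, t, z} \<subseteq> ?P" by blast
  moreover have "?P \<subseteq> K" if K: "subgroup K G" "{a, b, t, z} \<subseteq> K" for K
  proof -
    have "z [^] j \<in> K" for j :: nat
      using subgroup_int_pow_closed[OF K(1), of z "int j"] K(2) by (simp add: int_pow_int)
    then show ?thesis
      using K by (auto simp: normal_form_def base_def flip_def subgroup_int_pow_closed
          subgroup.m_closed subgroup.one_closed)
  qed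
  ultimately show ?thesis
    by (intro generateI[symmetric]) auto
qed

lemma base_normal:
  assumes "carrier G = generate G {a, b, t, z}"
  shows "generate G {a, b} \<lhd> G"
proof -
  have "x \<otimes> h \<otimes> inv x \<in> generate G {a, b}" if "x \<in> carrier G" "h \<in> generate G {a, b}" for x h
  proof -
    from that obtain \<epsilon> j w v where x: "x = normal_form \<epsilon> j w" and h: "h = base v"
      by (auto simp: assms generate_normal_form generate_base)
    obtain v' where v': "z [^] j \<otimes> base v = base v' \<otimes> z [^] j" using z_pow_base by blast
    obtain v'' where v'': "flip \<epsilon> \<otimes> base v' = base v'' \<otimes> flip \<epsilon>" using flip_base by blast
    have "x \<otimes> h = flip \<epsilon> \<otimes> (z [^] j \<otimes> base v) \<otimes> base w"
      by (simp add: x h normal_form_base) (simp add: normal_form_def m_assoc add.commute flip: base_add)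
    also have "\<dots> = (flip \<epsilon> \<otimes> base v') \<otimes> z [^] j \<otimes> base w"
      by (simp add: v' m_assoc)
    also have "\<dots> = base v'' \<otimes> x"
      by (simp add: v'' x normal_form_def m_assoc)
    finally have "x \<otimes> h \<otimes> inv x = base v''"
      using that(1) by (simp add: m_assoc)
    then show ?thesis by (simp add: generate_base)
  qed
  moreover have "subgroup (generate G {a, b}) G"
    by (rule generate_is_subgroup) simp
  ultimately show ?thesis by (simp add: normal_inv_iff)
qed

lemma generate_product:
  "generate G {a, b, t, z} = generate G {a, b, t} <#> generate G {z}"
proof
  show "generate G {a, b, t, z} \<subseteq> generate G {a, b, t} <#> generate G {z}"
  proof
    fix x assume "x \<in> generate G {a, b, t, z}"
    then obtain \<epsilon> j w where x: "x = normal_form \<epsilon> j w"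
      by (auto simp: generate_normal_form)
    obtain w' where w': "z [^] j \<otimes> base w = base w' \<otimes> z [^] j" using z_pow_base by blast
    obtain w'' where w'': "flip \<epsilon> \<otimes> base w' = base w'' \<otimes> flip \<epsilon>" using flip_base by blast
    have "x = flip \<epsilon> \<otimes> (z [^] j \<otimes> base w)"
      by (simp add: x normal_form_def m_assoc)
    also have "\<dots> = (flip \<epsilon> \<otimes> base w') \<otimes> z [^] j"
      by (simp add: w' m_assoc)
    finally have "x = (base w'' \<otimes> flip \<epsilon>) \<otimes> z [^] int j"
      by (simp add: w'' int_pow_int)
    moreover have "base w'' \<otimes> flip \<epsilon> \<in> generate G {a, b, t}"
      by (auto simp: generate_wreath)
    moreover have "z [^] int j \<in> generate G {z}"
      by (auto simp: generate_pow)
    ultimately show "x \<in> generate G {a, b, t} <#> generate G {z}"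
      by (auto simp: set_mult_def)
  qed
  have "generate G {a, b, t} \<subseteq> generate G {a, b, t, z}" "generate G {z} \<subseteq> generate G {a, b, t, z}"
    by (intro mono_generate; blast)+
  then show "generate G {a, b, t} <#> generate G {z} \<subseteq> generate G {a, b, t, z}"
    by (auto simp: set_mult_def intro: generate.eng)
qed

text \<open>Each condition compares two normal forms of one element: of \<open>v z\<^sup>M\<close>, of \<open>v z t\<close>, of \<open>z t t\<close> and of
\<open>z\<^sup>M t\<close>.\<close>

lemma normal_form_unique_imp_consistent:
  assumes unique: "\<And>i j v w. z [^] (i :: nat) \<otimes> base v = z [^] (j :: nat) \<otimes> base w
    \<Longrightarrow> [i = j] (mod M) \<and> vec_cong N v w"
  shows consistent
proof -
  have "mat_cong N (mat_power Z M) (mat 1)"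
  proof (rule mat_cong_eq_rows)
    fix v
    have "z [^] M \<otimes> base (v v* mat_power Z M) = z [^] M \<otimes> base v"
      using base_z_pow[of v M] z_pow by simp
    then show "vec_cong N (v v* mat_power Z M) (v v* mat 1)"
      using unique by simp
  qed
  moreover have "mat_cong N (Z ** J) (J ** mat_power Z k)"
  proof (rule mat_cong_eq_rows)
    fix v
    have "base v \<otimes> (z \<otimes> t) = base v \<otimes> z \<otimes> t"
      by (simp add: m_assoc)
    also have "\<dots> = z \<otimes> (base (v v* Z) \<otimes> t)"
      by (simp add: base_z m_assoc)
    also have "\<dots> = z \<otimes> t \<otimes> base (v v* Z v* J)"
      by (simp add: base_t m_assoc)
    also have "\<dots> = t \<otimes> (z [^] k \<otimes> base (u + v v* Z v* J))"
      by (simp add: z_t m_assoc base_add)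
    finally have 1: "base v \<otimes> (z \<otimes> t) = t \<otimes> (z [^] k \<otimes> base (u + v v* Z v* J))" .
    have "base v \<otimes> (z \<otimes> t) = (base v \<otimes> t) \<otimes> z [^] k \<otimes> base u"
      by (simp add: z_t m_assoc)
    also have "\<dots> = t \<otimes> (base (v v* J) \<otimes> z [^] k) \<otimes> base u"
      by (simp add: base_t m_assoc)
    also have "\<dots> = t \<otimes> (z [^] k \<otimes> base (v v* J v* mat_power Z k + u))"
      by (simp add: base_z_pow m_assoc base_add)
    finally have "z [^] k \<otimes> base (u + v v* Z v* J) = z [^] k \<otimes> base (v v* J v* mat_power Z k + u)"
      using 1 by simp
    then have "vec_cong N (u + v v* Z v* J) (v v* J v* mat_power Z k + u)"
      using unique by blast
    then have "vec_cong N (v v* Z v* J) (v v* J v* mat_power Z k)"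
      using vec_cong_add[OF _ vec_cong_refl[of N "- u"]] by fastforce
    then show "vec_cong N (v v* (Z ** J)) (v v* (J ** mat_power Z k))"
      by (simp add: vector_matrix_mul_assoc)
  qed
  moreover have "[k * k = 1] (mod M) \<and> vec_cong N (u v* (S_mat k (mat_power Z k) + J)) 0"
  proof -
    have "normal_form False 1 0 \<otimes> t \<otimes> t
        = normal_form False (k * k) (u v* (S_mat k (mat_power Z k) + J))"
      by (simp add: normal_form_t S_mat_Suc vector_matrix_mult_add_rdistrib)
    moreover have "normal_form False 1 0 \<otimes> t \<otimes> t = normal_form False 1 0"
      by (simp add: m_assoc t_square)
    ultimately have "z [^] (k * k) \<otimes> base (u v* (S_mat k (mat_power Z k) + J))
        = z [^] (1 :: nat) \<otimes> base 0"
      by (simp add: normal_form_def flip_def)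
    then show ?thesis using unique by blast
  qed
  moreover have "vec_cong N (u v* S_mat M (mat_power Z k)) 0"
  proof -
    have "t \<otimes> (z [^] (k * M) \<otimes> base (u v* S_mat M (mat_power Z k))) = t \<otimes> (z [^] (0 :: nat) \<otimes> base 0)"
      using z_pow_t[of M] z_pow by (simp add: m_assoc)
    then have "z [^] (k * M) \<otimes> base (u v* S_mat M (mat_power Z k)) = z [^] (0 :: nat) \<otimes> base 0"
      by simp
    then show ?thesis using unique by blast
  qed
  ultimately show ?thesis
    unfolding consistent_def by blast
qed

text \<open>Two normal forms of one element differ by an element of the base that is also a power of \<open>z\<close>.
It is trivial because the two factors meet trivially; faithfulness and the order of \<open>z\<close> then
determine the exponents.\<close>

lemma exact_imp_consistent:
  assumes faithful and ord: "ord z = M"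
    and disjoint: "generate G {a, b, t} \<inter> generate G {z} = {\<one>}"
  shows consistent
proof (rule normal_form_unique_imp_consistent)
  fix i j :: nat and v w
  assume eq: "z [^] i \<otimes> base v = z [^] j \<otimes> base w"
  have "base (v - w) = base v \<otimes> inv (base w)"
    using base_add[of v "- w"] by (simp add: inv_base)
  also have "\<dots> = inv (z [^] i) \<otimes> (z [^] i \<otimes> base v) \<otimes> inv (base w)"
    by (simp add: m_assoc[symmetric])
  also have "\<dots> = inv (z [^] i) \<otimes> z [^] j"
    unfolding eq by (simp add: m_assoc)
  also have "\<dots> = z [^] (int j - int i)"
    using int_pow_mult[OF z_closed, of "- int i" "int j"]
    by (simp add: int_pow_neg int_pow_int)
  finally have eq': "base (v - w) = z [^] (int j - int i)" .
  have "base (v - w) = base (v - w) \<otimes> flip False"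
    by (simp add: flip_def)
  then have "base (v - w) \<in> generate G {a, b, t}"
    unfolding generate_wreath by blast
  moreover have "base (v - w) \<in> generate G {z}"
    unfolding eq' by (auto simp: generate_pow)
  ultimately have one: "base (v - w) = \<one>"
    using disjoint by blast
  then have "base (v - w) \<otimes> flip False = \<one>"
    by (simp add: flip_def)
  then have "vec_cong N (v - w) 0"
    using assms(1) unfolding faithful_def by blast
  moreover have "int M dvd int j - int i"
    using eq' one ord int_pow_eq_id[OF z_closed] by metis
  then have "[i = j] (mod M)"
    by (metis cong_iff_dvd_diff cong_int_iff cong_sym)
  ultimately show "[i = j] (mod M) \<and> vec_cong N v w"
    by (simp add: vec_cong_diff_0)
qed

end


section \<open>An action on normal forms\<close>

lemma UNIV_ext_gen: "UNIV = {Ga, Gb, Gt, Gz}"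
proof -
  have "x \<in> {Ga, Gb, Gt, Gz}" for x by (cases x) simp_all
  then show ?thesis by blast
qed

lemma wpow_gen: "wpow (gen x) i = replicate (nat \<bar>i\<bar>) (x, 0 \<le> i)"
proof -
  have "concat (replicate n [l]) = replicate n l" for n and l :: "'g \<times> bool"
    by (induction n) simp_all
  then show ?thesis by (simp add: wpow_def gen_def winv_def)
qed

type_synonym state = "bool \<times> nat \<times> (int ^ 2)"

context ext_params
begin

text \<open>Right multiplication of the formal normal form \<open>t\<^sup>\<epsilon> z\<^sup>j v\<close> by a letter. The clauses are those of
\<open>normal_form_base\<close>, \<open>normal_form_z_pow\<close> and \<open>normal_form_t\<close>, with \<open>z\<^bsup>M-1\<^esup>\<close> and \<open>t\<close> for the inverse
letters. Reducing exponents is postponed: states are compared only up to \<open>state_cong\<close>, so that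
no quotient and no group of permutations has to be formed.\<close>

fun letter_act :: "state \<Rightarrow> ext_gen \<times> bool \<Rightarrow> state" where
  "letter_act (\<epsilon>, j, v) (Ga, d) = (\<epsilon>, j, v + vector [if d then 1 else - 1, 0])"
| "letter_act (\<epsilon>, j, v) (Gb, d) = (\<epsilon>, j, v + vector [0, if d then 1 else - 1])"
| "letter_act (\<epsilon>, j, v) (Gt, d) = (\<not> \<epsilon>, k * j, u v* S_mat j (mat_power Z k) + v v* J)"
| "letter_act (\<epsilon>, j, v) (Gz, d) =
     (let i = (if d then 1 else M - 1) in (\<epsilon>, j + i, v v* mat_power Z i))"

definition word_act :: "state \<Rightarrow> ext_gen gword \<Rightarrow> state" where
  "word_act = foldl letter_act"

fun state_cong :: "state \<Rightarrow> state \<Rightarrow> bool" where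
  "state_cong (\<epsilon>, j, v) (\<epsilon>', j', v') \<longleftrightarrow> \<epsilon> = \<epsilon>' \<and> [j = j'] (mod M) \<and> vec_cong N v v'"

lemma state_cong_refl [simp]: "state_cong x x"
  by (cases x) simp

lemma state_cong_sym: "state_cong x y \<Longrightarrow> state_cong y x"
  by (cases x; cases y) (simp add: cong_sym vec_cong_sym)

lemma state_cong_trans: "state_cong x y \<Longrightarrow> state_cong y w \<Longrightarrow> state_cong x w"
  by (cases x; cases y; cases w) (auto intro: cong_trans vec_cong_trans)

lemma word_act_Nil [simp]: "word_act x [] = x"
  and word_act_Cons [simp]: "word_act x (l # p) = word_act (letter_act x l) p"
  and word_act_append: "word_act x (p @ q) = word_act (word_act x p) q"
  by (simp_all add: word_act_def)

lemma word_act_a_pow: "word_act (\<epsilon>, j, v) (wpow (gen Ga) i) = (\<epsilon>, j, v + vector [i, 0])"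
proof -
  have "word_act (\<epsilon>, j, v) (replicate n (Ga, d)) = (\<epsilon>, j, v + vector [if d then int n else - int n, 0])"
    for n d
    by (induction n arbitrary: v) (auto simp: vec_eq_iff_2)
  then show ?thesis by (simp add: wpow_gen)
qed

lemma word_act_b_pow: "word_act (\<epsilon>, j, v) (wpow (gen Gb) i) = (\<epsilon>, j, v + vector [0, i])"
proof -
  have "word_act (\<epsilon>, j, v) (replicate n (Gb, d)) = (\<epsilon>, j, v + vector [0, if d then int n else - int n])"
    for n d
    by (induction n arbitrary: v) (auto simp: vec_eq_iff_2)
  then show ?thesis by (simp add: wpow_gen)
qed

lemma word_act_z_pow:
  "\<exists>p. [int p = i] (mod int M) \<and>
     (\<forall>\<epsilon> j v. word_act (\<epsilon>, j, v) (wpow (gen Gz) i) = (\<epsilon>, j + p, v v* mat_power Z p))"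
proof -
  define step where "step = (if 0 \<le> i then 1 else M - 1)"
  have "letter_act (\<epsilon>, j, v) (Gz, 0 \<le> i) = (\<epsilon>, j + step, v v* mat_power Z step)" for \<epsilon> j v
    by (simp add: step_def Let_def)
  then have "word_act (\<epsilon>, j, v) (replicate n (Gz, 0 \<le> i))
      = (\<epsilon>, j + n * step, v v* mat_power Z (n * step))" for n \<epsilon> j v
    by (induction n arbitrary: j v)
      (simp_all add: vector_matrix_mul_assoc mat_power_add[symmetric] del: letter_act.simps)
  moreover have "[int (nat \<bar>i\<bar> * step) = i] (mod int M)"
  proof (cases "0 \<le> i")
    case False
    have "int (nat \<bar>i\<bar> * step) = i + int M * (- i)"
      using False M_pos by (simp add: step_def of_nat_diff algebra_simps)
    then show ?thesis by (simp only: cong_iff_dvd_diff) simp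
  qed (simp add: step_def)
  ultimately show ?thesis
    by (intro exI[of _ "nat \<bar>i\<bar> * step"]) (simp add: wpow_gen)
qed

context
  assumes consistent
begin

lemma Z_pow_cong: "mat_cong N (mat_power Z M) (mat 1)"
  and Z_J_cong: "mat_cong N (Z ** J) (J ** mat_power Z k)"
  and k_square_cong: "[k * k = 1] (mod M)"
  and u_t_cong: "vec_cong N (u v* (S_mat k (mat_power Z k) + J)) 0"
  and u_M_cong: "vec_cong N (u v* S_mat M (mat_power Z k)) 0"
  using \<open>consistent\<close> unfolding consistent_def by simp_all

lemma Z_k_J_cong: "mat_cong N (mat_power Z k ** J) (J ** Z)"
proof -
  have "mat_cong N (J ** (J ** mat_power Z k) ** J) (J ** (Z ** J) ** J)"
    by (intro mat_cong_mult mat_cong_refl mat_cong_sym[OF Z_J_cong])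
  moreover have "J ** (J ** mat_power Z k) ** J = (J ** J) ** mat_power Z k ** J"
    "J ** (Z ** J) ** J = J ** Z ** (J ** J)"
    by (simp_all only: matrix_mul_assoc)
  ultimately show ?thesis by (simp add: J_mat swap_square)
qed

lemma Z_k_k_cong: "mat_cong N (mat_power (mat_power Z k) k) Z"
  using mat_power_cong_exponent[OF Z_pow_cong k_square_cong] by (simp add: mat_power_mult)

text \<open>The clause for \<open>t\<close> is well defined on exponents modulo \<open>M\<close>: the sum over a full period \<open>M\<close> is a
factor of the sum over any multiple of \<open>M\<close>, and it annihilates \<open>u\<close> by the fifth condition.\<close>

lemma u_S_mat_cong:
  assumes "[i = j] (mod M)"
  shows "vec_cong N (u v* S_mat i (mat_power Z k)) (u v* S_mat j (mat_power Z k))"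
proof -
  let ?X = "mat_power Z k"
  have red: "vec_cong N (u v* S_mat i ?X) (u v* S_mat (i mod M) ?X)" for i
  proof -
    have "S_mat i ?X = S_mat (i mod M + M * (i div M)) ?X"
      by simp
    also have "\<dots> = S_mat (i mod M) ?X
        + S_mat M ?X ** (S_mat (i div M) (mat_power ?X M) ** mat_power ?X (i mod M))"
      by (simp only: S_mat_add S_mat_mult matrix_mul_assoc)
    finally have "u v* S_mat i ?X = u v* S_mat (i mod M) ?X
        + (u v* S_mat M ?X) v* (S_mat (i div M) (mat_power ?X M) ** mat_power ?X (i mod M))"
      by (simp only: vector_matrix_mult_add_rdistrib vector_matrix_mul_assoc)
    also have "vec_cong N \<dots> (u v* S_mat (i mod M) ?X
        + 0 v* (S_mat (i div M) (mat_power ?X M) ** mat_power ?X (i mod M)))"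
      by (intro vec_cong_add vec_cong_mult vec_cong_refl mat_cong_refl u_M_cong)
    finally show ?thesis by simp
  qed
  show ?thesis
    using red[of i] red[of j] assms vec_cong_sym vec_cong_trans unfolding cong_def by metis
qed

lemma letter_act_cong: "state_cong x y \<Longrightarrow> state_cong (letter_act x l) (letter_act y l)"
proof -
  assume xy: "state_cong x y"
  obtain \<epsilon> j v where x: "x = (\<epsilon>, j, v)" by (cases x)
  obtain \<epsilon>' j' v' where y: "y = (\<epsilon>', j', v')" by (cases y)
  obtain g d where l: "l = (g, d)" by (cases l)
  show ?thesis
  proof (cases g)
    case Gz
    with xy show ?thesis
      by (simp only: x y l Gz Let_def letter_act.simps state_cong.simps)
        (intro conjI cong_add vec_cong_mult cong_refl mat_cong_refl; simp)
  qed (use xy in \<open>auto simp: x y l intro!: vec_cong_add vec_cong_mult cong_mult u_S_mat_cong\<close>)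
qed

lemma word_act_cong: "state_cong x y \<Longrightarrow> state_cong (word_act x p) (word_act y p)"
  by (induction p arbitrary: x y) (simp_all add: letter_act_cong)

text \<open>The square of \<open>t\<close> adds \<open>u S\<^bsub>k j\<^esub>(Z\<^sup>k) + u S\<^sub>j(Z\<^sup>k) J\<close>. The first sum factors as \<open>S\<^sub>k(Z\<^sup>k) S\<^sub>j(Z)\<close>
because \<open>Z\<^bsup>k k\<^esup> = Z\<close>, the second is \<open>J S\<^sub>j(Z)\<close> because \<open>Z\<^sup>k J = J Z\<close>, and the fourth condition
annihilates \<open>u (S\<^sub>k(Z\<^sup>k) + J)\<close>.\<close>

lemma t_t_act: "state_cong (letter_act (letter_act x (Gt, d)) (Gt, d')) x"
proof -
  obtain \<epsilon> j v where x: "x = (\<epsilon>, j, v)" by (cases x)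
  let ?X = "mat_power Z k"
  have "[k * (k * j) = j] (mod M)"
    using cong_mult[OF k_square_cong cong_refl[of j]] by (simp add: mult.assoc)
  moreover have "vec_cong N (u v* S_mat (k * j) ?X + (u v* S_mat j ?X + v v* J) v* J) v"
  proof -
    have "u v* S_mat (k * j) ?X + (u v* S_mat j ?X + v v* J) v* J
        = u v* (S_mat k ?X ** S_mat j (mat_power ?X k) + S_mat j ?X ** J) + v"
      by (simp add: S_mat_mult vector_matrix_left_distrib vector_matrix_mul_assoc J_mat swap_square
          vector_matrix_mult_add_rdistrib)
    also have "vec_cong N \<dots> (u v* (S_mat k ?X ** S_mat j Z + J ** S_mat j Z) + v)"
      by (intro vec_cong_add vec_cong_mult mat_cong_add mat_cong_mult vec_cong_refl mat_cong_refl
          S_mat_cong Z_k_k_cong S_mat_intertwine Z_k_J_cong)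
    also have "u v* (S_mat k ?X ** S_mat j Z + J ** S_mat j Z) = (u v* (S_mat k ?X + J)) v* S_mat j Z"
      by (simp only: matrix_mult_add_distrib_right[symmetric] vector_matrix_mul_assoc)
    also have "vec_cong N ((u v* (S_mat k ?X + J)) v* S_mat j Z + v) (0 v* S_mat j Z + v)"
      by (intro vec_cong_add vec_cong_mult vec_cong_refl mat_cong_refl u_t_cong)
    finally show ?thesis by simp
  qed
  ultimately show ?thesis by (simp add: x)
qed

lemma Z_pow_vec_cong: "vec_cong N (v v* mat_power Z M) v"
  using vec_cong_mult[OF vec_cong_refl Z_pow_cong, of v] by simp

lemma cancel_act: "state_cong (letter_act (letter_act x (g, d)) (g, \<not> d)) x"
proof -
  obtain \<epsilon> j v where x: "x = (\<epsilon>, j, v)" by (cases x)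
  show ?thesis
  proof (cases g)
    case Gz
    have "mat_power Z (M - 1) ** Z = mat_power Z M" "Z ** mat_power Z (M - 1) = mat_power Z M"
      using mat_power_add[of Z "M - 1" 1] mat_power_add[of Z 1 "M - 1"] M_pos by simp_all
    moreover have "[j + M = j] (mod M)"
      by (simp add: cong_def)
    ultimately show ?thesis
      using Z_pow_vec_cong[of v] M_pos by (simp add: x Gz Let_def vector_matrix_mul_assoc)
  next
    case Gt
    then show ?thesis by (simp only: t_t_act)
  qed (simp_all add: x vec_cong_iff)
qed

lemma conj_t_act:
  assumes "\<And>\<epsilon> j v. word_act (\<epsilon>, j, v) (gen g) = (\<epsilon>, j, v + w)"
    and "\<And>\<epsilon> j v. word_act (\<epsilon>, j, v) (gen g') = (\<epsilon>, j, v + w v* J)"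
  shows "state_cong (word_act x (wconj (gen g) (gen Gt))) (word_act x (gen g'))"
proof -
  obtain \<epsilon> j v where x: "x = (\<epsilon>, j, v)" by (cases x)
  obtain \<epsilon>' j' v' where tt: "letter_act (letter_act x (Gt, False)) (Gt, True) = (\<epsilon>', j', v')"
    by (cases "letter_act (letter_act x (Gt, False)) (Gt, True)")
  have "state_cong (\<epsilon>', j', v') x"
    using t_t_act[of x False True] by (simp add: tt)
  then have "state_cong (\<epsilon>', j', v' + w v* J) (\<epsilon>, j, v + w v* J)"
    by (simp add: x vec_cong_add)
  moreover have "word_act x (wconj (gen g) (gen Gt)) = (\<epsilon>', j', v' + w v* J)"
    using tt assms(1)[unfolded gen_def]
    by (auto simp: x wconj_def winv_def gen_def vector_matrix_left_distrib add.assoc)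
  ultimately show ?thesis
    by (simp add: x assms(2))
qed

lemma conj_z_act:
  assumes "\<And>\<epsilon> j v. word_act (\<epsilon>, j, v) (gen g) = (\<epsilon>, j, v + w)"
    and "w v* Z = vector [p, q]"
  shows "state_cong (word_act x (wconj (gen g) (gen Gz))) (word_act x (wpow (gen Ga) p @ wpow (gen Gb) q))"
proof -
  obtain \<epsilon> j v where x: "x = (\<epsilon>, j, v)" by (cases x)
  have Z: "mat_power Z (M - 1) ** Z = mat_power Z M"
    using mat_power_add[of Z "M - 1" 1] M_pos by simp
  have "word_act x (wconj (gen g) (gen Gz)) = (\<epsilon>, j + M, v v* mat_power Z M + w v* Z)"
    using assms(1)[unfolded gen_def] Z M_pos
    by (simp add: x wconj_def winv_def gen_def Let_def vector_matrix_left_distrib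
        vector_matrix_mul_assoc)
  moreover have "word_act x (wpow (gen Ga) p @ wpow (gen Gb) q) = (\<epsilon>, j, v + w v* Z)"
    by (simp add: x word_act_append word_act_a_pow word_act_b_pow assms(2) vec_eq_iff_2)
  moreover have "vec_cong N (v v* mat_power Z M + w v* Z) (v + w v* Z)"
    by (intro vec_cong_add Z_pow_vec_cong vec_cong_refl)
  ultimately show ?thesis by (simp add: cong_def)
qed

text \<open>The relation for \<open>t\<^sup>z\<close> is equivalent to \<open>t z = z t z\<^bsup>2c\<^esup> a\<^sup>r b\<^sup>s\<close>, which avoids the inverse of \<open>z\<close>.
Both sides then agree because \<open>Z J = J Z\<^sup>k\<close>, \<open>Z\<^bsup>k+2c\<^esup> = Z\<close> and \<open>u Z\<^bsup>2c\<^esup> = - (r, s)\<close>.\<close>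

lemma t_conj_z_act:
  "state_cong (word_act x (wconj (gen Gt) (gen Gz)))
     (word_act x (gen Gt @ wpow (gen Gz) (2 * c) @ wpow (gen Ga) r @ wpow (gen Gb) s))"
proof -
  let ?X = "mat_power Z k" and ?rs = "vector [r, s] :: int ^ 2"
  let ?q = "gen Gt @ wpow (gen Gz) (2 * c) @ wpow (gen Ga) r @ wpow (gen Gb) s"
  obtain p where p: "[int p = 2 * c] (mod int M)"
    and z_pow: "\<And>\<epsilon> j v. word_act (\<epsilon>, j, v) (wpow (gen Gz) (2 * c)) = (\<epsilon>, j + p, v v* mat_power Z p)"
    using word_act_z_pow[of "2 * c"] by blast
  have "[int (k + p) = int 1] (mod int M)"
    using cong_add[OF k_cong p] by simp
  then have k_p: "[k + p = 1] (mod M)" by (simp only: cong_int_iff)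
  have "[int (e + p) = int 0] (mod int M)"
    using cong_add[OF e_cong p] by simp
  then have e_p: "[e + p = 0] (mod M)" by (simp only: cong_int_iff)
  have Z_k_p: "mat_cong N (?X ** mat_power Z p) Z"
    using mat_power_cong_exponent[OF Z_pow_cong k_p] by (simp add: mat_power_add)
  have Z_e_p: "mat_cong N (mat_power Z e ** mat_power Z p) (mat 1)"
    using mat_power_cong_exponent[OF Z_pow_cong e_p] by (simp add: mat_power_add)
  have u_p: "vec_cong N (u v* mat_power Z p + ?rs) 0"
  proof -
    have "u v* mat_power Z p = - (?rs v* (mat_power Z e ** mat_power Z p))"
      by (simp add: u_def vector_matrix_mult_uminus vector_matrix_mul_assoc)
    also have "vec_cong N \<dots> (- (?rs v* mat 1))"
      by (intro vec_cong_uminus vec_cong_mult vec_cong_refl Z_e_p)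
    finally show ?thesis
      using vec_cong_add[OF _ vec_cong_refl[of N ?rs]] by fastforce
  qed
  \<comment> \<open>The relation without inverses; below it is applied to the state \<open>y = x z\<^sup>-\<^sup>1\<close>.\<close>
  have main: "state_cong (word_act y [(Gt, True), (Gz, True)]) (word_act (letter_act y (Gz, True)) ?q)" for y
  proof -
    obtain \<epsilon> j v where y: "y = (\<epsilon>, j, v)" by (cases y)
    have lhs: "word_act y [(Gt, True), (Gz, True)]
        = (\<not> \<epsilon>, k * j + 1, u v* S_mat j ?X v* Z + v v* (J ** Z))"
      by (simp add: y Let_def vector_matrix_left_distrib vector_matrix_mul_assoc)
    have rhs: "word_act (letter_act y (Gz, True)) ?q
        = (\<not> \<epsilon>, k * (j + 1) + p,
            (u v* S_mat (Suc j) ?X + v v* Z v* J) v* mat_power Z p + ?rs)"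
      by (simp add: y Let_def gen_def[of Gt] word_act_append z_pow word_act_a_pow word_act_b_pow
          vec_eq_iff_2)
    have "[k * j + (k + p) = k * j + 1] (mod M)"
      by (intro cong_add cong_refl k_p)
    then have "[k * j + 1 = k * (j + 1) + p] (mod M)"
      by (simp add: cong_sym_eq algebra_simps)
    moreover have "vec_cong N ((u v* S_mat (Suc j) ?X + v v* Z v* J) v* mat_power Z p + ?rs)
        (u v* S_mat j ?X v* Z + v v* (J ** Z))"
    proof -
      have "(u v* S_mat (Suc j) ?X + v v* Z v* J) v* mat_power Z p + ?rs
          = u v* S_mat j ?X v* (?X ** mat_power Z p) + v v* ((Z ** J) ** mat_power Z p)
            + (u v* mat_power Z p + ?rs)"
        by (simp add: S_mat_Suc vector_matrix_left_distrib vector_matrix_mult_add_rdistrib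
            vector_matrix_mul_assoc matrix_mul_assoc)
      also have "vec_cong N \<dots>
          (u v* S_mat j ?X v* Z + v v* ((J ** ?X) ** mat_power Z p) + 0)"
        by (intro vec_cong_add vec_cong_mult vec_cong_refl mat_cong_refl mat_cong_mult
            Z_k_p Z_J_cong u_p)
      also have "(J ** ?X) ** mat_power Z p = J ** (?X ** mat_power Z p)"
        by (simp only: matrix_mul_assoc)
      also have "vec_cong N (u v* S_mat j ?X v* Z + v v* (J ** (?X ** mat_power Z p)) + 0)
          (u v* S_mat j ?X v* Z + v v* (J ** Z) + 0)"
        by (intro vec_cong_add vec_cong_mult vec_cong_refl mat_cong_refl mat_cong_mult Z_k_p)
      finally show ?thesis by simp
    qed
    ultimately show ?thesis
      unfolding lhs rhs by (simp add: vec_cong_sym)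
  qed
  have "state_cong (word_act x (wconj (gen Gt) (gen Gz)))
      (word_act (letter_act (letter_act x (Gz, False)) (Gz, True)) ?q)"
    using main[of "letter_act x (Gz, False)"] by (simp add: wconj_def winv_def gen_def[of Gz] gen_def[of Gt])
  moreover have "state_cong (word_act (letter_act (letter_act x (Gz, False)) (Gz, True)) ?q) (word_act x ?q)"
    using word_act_cong[OF cancel_act[of x Gz False]] by simp
  ultimately show ?thesis by (rule state_cong_trans)
qed

lemma relation_act:
  assumes "(p, q) \<in> ext_relations N M \<alpha> \<beta> \<gamma> \<delta> r s c"
  shows "state_cong (word_act x p) (word_act x q)"
proof -
  obtain \<epsilon> j v where x: "x = (\<epsilon>, j, v)" by (cases x)
  have gen_a: "word_act (\<epsilon>, j, v) (gen Ga) = (\<epsilon>, j, v + vector [1, 0])"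
    and gen_b: "word_act (\<epsilon>, j, v) (gen Gb) = (\<epsilon>, j, v + vector [0, 1])" for \<epsilon> j v
    by (simp_all add: gen_def)
  have a: "state_cong (word_act x (wpow (gen Ga) (int N))) x"
    and b: "state_cong (word_act x (wpow (gen Gb) (int N))) x"
    by (simp_all add: x word_act_a_pow word_act_b_pow vec_cong_iff cong_def)
  have t: "state_cong (word_act x (wpow (gen Gt) 2)) x"
    using t_t_act[of x True True] by (simp add: wpow_gen numeral_2_eq_2 del: letter_act.simps)
  have ab: "state_cong (word_act x (wcomm (gen Ga) (gen Gb))) x"
    by (simp add: x wcomm_def winv_def gen_def vec_cong_iff)
  have "vector [1, 0] v* J = vector [0, 1]" "vector [0, 1] v* J = vector [1, 0]"
    by (simp_all add: J_mat vector_mult_mat2)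
  note J_swap = this
  have at: "state_cong (word_act x (wconj (gen Ga) (gen Gt))) (word_act x (gen Gb))"
    by (rule conj_t_act[OF gen_a]) (simp add: gen_b J_swap)
  have bt: "state_cong (word_act x (wconj (gen Gb) (gen Gt))) (word_act x (gen Ga))"
    by (rule conj_t_act[OF gen_b]) (simp add: gen_a J_swap)
  have z: "state_cong (word_act x (wpow (gen Gz) (int M))) x"
  proof -
    obtain p where "[int p = int M] (mod int M)"
      "word_act x (wpow (gen Gz) (int M)) = (\<epsilon>, j + p, v v* mat_power Z p)"
      using word_act_z_pow[of "int M"] x by blast
    moreover from this have "[p = 0] (mod M)"
      by (simp only: cong_int_iff) (simp add: cong_def)
    moreover from this have "vec_cong N (v v* mat_power Z p) (v v* mat_power Z 0)"
      by (intro vec_cong_mult vec_cong_refl mat_power_cong_exponent[OF Z_pow_cong])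
    moreover have "[j + p = j + 0] (mod M)"
      using \<open>[p = 0] (mod M)\<close> by (intro cong_add cong_refl)
    ultimately show ?thesis by (simp add: x)
  qed
  have az: "state_cong (word_act x (wconj (gen Ga) (gen Gz))) (word_act x (wpow (gen Ga) \<alpha> @ wpow (gen Gb) \<beta>))"
    by (rule conj_z_act[OF gen_a]) (simp add: Z_def vector_mult_mat2)
  have bz: "state_cong (word_act x (wconj (gen Gb) (gen Gz))) (word_act x (wpow (gen Ga) \<gamma> @ wpow (gen Gb) \<delta>))"
    by (rule conj_z_act[OF gen_b]) (simp add: Z_def vector_mult_mat2)
  show ?thesis
    using assms a b t ab at bt z az bz t_conj_z_act[of x]
    by (auto simp: ext_relations_def wreath_relations_def Let_def)
qed

lemma pres_eq_act:
  "pres_eq (ext_relations N M \<alpha> \<beta> \<gamma> \<delta> r s c) p q \<Longrightarrow> state_cong (word_act x p) (word_act x q)"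
proof (induction arbitrary: x rule: pres_eq.induct)
  case (sym p q)
  then show ?case by (blast intro: state_cong_sym)
next
  case (trans p q w)
  then show ?case by (blast intro: state_cong_trans)
next
  case (cancel p g d q)
  then show ?case
    using word_act_cong[OF cancel_act] by (simp add: word_act_append)
next
  case (rel p' q' p q)
  then show ?case
    using word_act_cong[OF relation_act] by (simp add: word_act_append)
qed simp

text \<open>The hypothesis equates an element of \<open>\<langle>a, b, t\<rangle>\<close> with a power of \<open>z\<close>. Both words are applied to the
state \<open>(False, 0, 0)\<close> of the identity; the results are congruent states, which leaves only the
trivial element.\<close>

lemma pres_eq_normal_form:
  assumes "pres_eq (ext_relations N M \<alpha> \<beta> \<gamma> \<delta> r s c)
     (wpow (gen Ga) p @ wpow (gen Gb) q @ (if \<epsilon> then gen Gt else [])) (wpow (gen Gz) i)"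
  shows "\<not> \<epsilon>" and "vec_cong N (vector [p, q]) 0" and "int M dvd i"
proof -
  obtain n where n: "[int n = i] (mod int M)"
    "\<And>v. word_act (False, 0, v) (wpow (gen Gz) i) = (False, n, v v* mat_power Z n)"
    using word_act_z_pow[of i] by fastforce
  have "state_cong (word_act (False, 0, 0) (wpow (gen Ga) p @ wpow (gen Gb) q @ (if \<epsilon> then gen Gt else [])))
      (False, n, 0)"
    using pres_eq_act[OF assms, of "(False, 0, 0)"] by (simp add: n)
  then have *: "\<not> \<epsilon> \<and> [0 = n] (mod M) \<and> vec_cong N (vector [p, 0] + vector [0, q]) 0"
    by (cases \<epsilon>) (simp_all add: word_act_append word_act_a_pow word_act_b_pow gen_def[of Gt])
  then show "\<not> \<epsilon>" "vec_cong N (vector [p, q]) 0"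
    by (simp_all add: vec_cong_iff)
  from * have "M dvd n"
    by (metis cong_0_iff cong_sym)
  then have "int M dvd int n"
    by simp
  with n(1) show "int M dvd i"
    using cong_dvd_iff dvd_refl cong_def by (metis cong_0_iff cong_sym cong_trans)
qed

end

lemma ext_group_quadruple:
  "ext_quadruple N M k e \<alpha> \<beta> \<gamma> \<delta> r s c Z J u (ext_group N M \<alpha> \<beta> \<gamma> \<delta> r s c)
     (ext_elem N M \<alpha> \<beta> \<gamma> \<delta> r s c Ga) (ext_elem N M \<alpha> \<beta> \<gamma> \<delta> r s c Gb)
     (ext_elem N M \<alpha> \<beta> \<gamma> \<delta> r s c Gt) (ext_elem N M \<alpha> \<beta> \<gamma> \<delta> r s c Gz)"
proof -
  let ?R = "ext_relations N M \<alpha> \<beta> \<gamma> \<delta> r s c" and ?G = "ext_group N M \<alpha> \<beta> \<gamma> \<delta> r s c"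
  let ?f = "ext_elem N M \<alpha> \<beta> \<gamma> \<delta> r s c"
  interpret word_valuation ?G ?f
    using word_valuation_presented_group[of ?R] by (simp add: ext_group_def ext_elem_def[abs_def])
  have rel: "word_eval ?G ?f p = word_eval ?G ?f q" if "(p, q) \<in> ?R" for p q
    using presented_group_relation[OF that] by (simp add: ext_group_def ext_elem_def[abs_def])
  have "wreath_triple ?G N (?f Ga) (?f Gb) (?f Gt) (mat2 0 1 1 0)"
    using wreath_relations_hold_iff[of N Ga Gb Gt] rel
    by (fastforce simp: ext_relations_def Let_def)
  moreover have
    "word_eval ?G ?f (wpow (gen Gz) (int M)) = word_eval ?G ?f []"
    "word_eval ?G ?f (wconj (gen Ga) (gen Gz)) = word_eval ?G ?f (wpow (gen Ga) \<alpha> @ wpow (gen Gb) \<beta>)"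
    "word_eval ?G ?f (wconj (gen Gb) (gen Gz)) = word_eval ?G ?f (wpow (gen Ga) \<gamma> @ wpow (gen Gb) \<delta>)"
    "word_eval ?G ?f (wconj (gen Gt) (gen Gz))
       = word_eval ?G ?f (gen Gt @ wpow (gen Gz) (2 * c) @ wpow (gen Ga) r @ wpow (gen Gb) s)"
    by (rule rel; simp add: ext_relations_def Let_def)+
  ultimately show ?thesis
    using ext_params_axioms J_mat f_closed[of Gz]
    by (simp add: ext_quadruple_def ext_quadruple_axioms_def word_eval_simps int_pow_int m_assoc
        del: f_closed) (simp add: m_assoc)
qed

end

lemma (in ext_quadruple) word_eval_base_flip:
  assumes "range f \<subseteq> carrier G" and "f Ga = a" "f Gb = b" "f Gt = t"
  shows "word_eval G f (wpow (gen Ga) (v $ 1) @ wpow (gen Gb) (v $ 2) @ (if \<epsilon> then gen Gt else []))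
    = base v \<otimes> flip \<epsilon>"
proof -
  interpret word_valuation G f
    using assms(1) by unfold_locales auto
  show ?thesis
    by (simp add: word_eval_simps assms base_def flip_def m_assoc)
qed

context ext_params
begin

interpretation E: ext_quadruple N M k e \<alpha> \<beta> \<gamma> \<delta> r s c Z J u
  "ext_group N M \<alpha> \<beta> \<gamma> \<delta> r s c"
  "ext_elem N M \<alpha> \<beta> \<gamma> \<delta> r s c Ga" "ext_elem N M \<alpha> \<beta> \<gamma> \<delta> r s c Gb"
  "ext_elem N M \<alpha> \<beta> \<gamma> \<delta> r s c Gt" "ext_elem N M \<alpha> \<beta> \<gamma> \<delta> r s c Gz"
  by (rule ext_group_quadruple)

lemma carrier_ext_group:
  "carrier (ext_group N M \<alpha> \<beta> \<gamma> \<delta> r s c) = generate (ext_group N M \<alpha> \<beta> \<gamma> \<delta> r s c)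
     {ext_elem N M \<alpha> \<beta> \<gamma> \<delta> r s c Ga, ext_elem N M \<alpha> \<beta> \<gamma> \<delta> r s c Gb,
      ext_elem N M \<alpha> \<beta> \<gamma> \<delta> r s c Gt, ext_elem N M \<alpha> \<beta> \<gamma> \<delta> r s c Gz}"
  using carrier_presented_group[of "ext_relations N M \<alpha> \<beta> \<gamma> \<delta> r s c"]
  by (simp add: ext_group_def ext_elem_def UNIV_ext_gen)

text \<open>Carries the result on words over to elements of \<open>G\<close>. The case \<open>i = 0\<close> yields faithfulness, the case
\<open>v = 0\<close>, \<open>\<epsilon> = False\<close> the order of \<open>z\<close>, and the general case the trivial intersection.\<close>

lemma consistent_imp_separated:
  assumes consistent
    and "E.base v \<otimes>\<^bsub>ext_group N M \<alpha> \<beta> \<gamma> \<delta> r s c\<^esub> E.flip \<epsilon>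
      = ext_elem N M \<alpha> \<beta> \<gamma> \<delta> r s c Gz [^]\<^bsub>ext_group N M \<alpha> \<beta> \<gamma> \<delta> r s c\<^esub> (i :: int)"
  shows "\<not> \<epsilon>" and "vec_cong N v 0" and "int M dvd i"
proof -
  let ?R = "ext_relations N M \<alpha> \<beta> \<gamma> \<delta> r s c" and ?G = "ext_group N M \<alpha> \<beta> \<gamma> \<delta> r s c"
  let ?f = "ext_elem N M \<alpha> \<beta> \<gamma> \<delta> r s c"
  let ?w = "wpow (gen Ga) (v $ 1) @ wpow (gen Gb) (v $ 2) @ (if \<epsilon> then gen Gt else [])"
  interpret word_valuation ?G ?f
    using word_valuation_presented_group[of ?R] by (simp add: ext_group_def ext_elem_def[abs_def])
  have eval: "word_eval ?G ?f w = pres_class ?R w" for w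
    by (simp add: ext_group_def ext_elem_def[abs_def] word_eval_presented_group)
  have "range ?f \<subseteq> carrier ?G" by auto
  then have "word_eval ?G ?f ?w = E.base v \<otimes>\<^bsub>?G\<^esub> E.flip \<epsilon>"
    by (rule E.word_eval_base_flip) simp_all
  also have "\<dots> = word_eval ?G ?f (wpow (gen Gz) i)"
    by (simp add: assms(2) word_eval_simps)
  finally have "pres_eq ?R ?w (wpow (gen Gz) i)"
    by (simp only: eval pres_class_eq_iff)
  from pres_eq_normal_form[OF assms(1) this]
  show "\<not> \<epsilon>" "vec_cong N v 0" "int M dvd i"
    by (simp_all add: vec_cong_iff)
qed

lemma consistent_imp_faithful: "consistent \<Longrightarrow> E.faithful"
  unfolding E.faithful_def using consistent_imp_separated(1,2)[where i = 0] by (metis int_pow_0)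

lemma consistent_imp_ord:
  assumes consistent
  shows "E.ord (ext_elem N M \<alpha> \<beta> \<gamma> \<delta> r s c Gz) = M"
proof -
  let ?G = "ext_group N M \<alpha> \<beta> \<gamma> \<delta> r s c" and ?z = "ext_elem N M \<alpha> \<beta> \<gamma> \<delta> r s c Gz"
  have "int M dvd int (E.ord ?z)"
    by (rule consistent_imp_separated(3)[OF assms, where v = 0 and \<epsilon> = False])
      (simp add: E.flip_def int_pow_int)
  moreover have "E.ord ?z dvd M"
    using E.z_pow by (simp add: E.pow_eq_id)
  ultimately show ?thesis
    by (simp add: dvd_antisym)
qed

lemma consistent_imp_disjoint:
  assumes consistent
  defines "G \<equiv> ext_group N M \<alpha> \<beta> \<gamma> \<delta> r s c" and "f \<equiv> ext_elem N M \<alpha> \<beta> \<gamma> \<delta> r s c"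
  shows "generate G {f Ga, f Gb, f Gt} \<inter> generate G {f Gz} = {\<one>\<^bsub>G\<^esub>}"
proof -
  have "x = \<one>\<^bsub>G\<^esub>" if "x \<in> generate G {f Ga, f Gb, f Gt}" "x \<in> generate G {f Gz}" for x
  proof -
    from that obtain v \<epsilon> i where x: "x = E.base v \<otimes>\<^bsub>G\<^esub> E.flip \<epsilon>" "x = f Gz [^]\<^bsub>G\<^esub> (i :: int)"
      unfolding G_def f_def E.generate_wreath E.generate_pow[OF E.z_closed] by blast
    then have "\<not> \<epsilon>" "vec_cong N v 0"
      using consistent_imp_separated[OF assms(1), of v \<epsilon> i] unfolding G_def f_def by auto
    then show ?thesis
      using E.base_cong[of v 0] x(1) by (simp add: E.flip_def G_def)
  qed
  then show ?thesis
    by (auto simp: generate.one)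
qed

end

text \<open>For \<open>M = 1\<close>, \<open>Z = I\<close> and \<open>r = s = c = 0\<close> the five conditions hold trivially. In that group
\<open>z\<close> is trivial, and the other three generators form a faithful triple.\<close>

lemma card_wreathed_group: "card (carrier (wreathed_group n)) = 2 * (2 ^ n)\<^sup>2"
proof -
  interpret P: ext_params "2 ^ n" 1 0 0 1 0 0 1 0 0 0 "mat2 1 0 0 1" "mat2 0 1 1 0" 0
    by unfold_locales (simp_all add: vec_eq_iff_2 vector_mult_mat2)
  interpret E: ext_quadruple "2 ^ n" 1 0 0 1 0 0 1 0 0 0 "mat2 1 0 0 1" "mat2 0 1 1 0" 0
    "ext_group (2 ^ n) 1 1 0 0 1 0 0 0"
    "ext_elem (2 ^ n) 1 1 0 0 1 0 0 0 Ga" "ext_elem (2 ^ n) 1 1 0 0 1 0 0 0 Gb"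
    "ext_elem (2 ^ n) 1 1 0 0 1 0 0 0 Gt" "ext_elem (2 ^ n) 1 1 0 0 1 0 0 0 Gz"
    by (rule P.ext_group_quadruple)
  have P.consistent
    unfolding P.consistent_def by (simp flip: mat_1_eq_mat2)
  then show ?thesis
    using E.faithful_imp_card_wreathed_group P.consistent_imp_faithful by blast
qed

theorem theorem5p1:
  fixes n m N M k e :: nat
    and \<alpha> \<beta> \<gamma> \<delta> r s c \<tau> \<nu> :: int
    and Z J :: "int ^ 2 ^ 2"
    and G :: "ext_gen gword set monoid"
    and a b t z :: "ext_gen gword set"
    and H K B :: "ext_gen gword set set"
  assumes "1 \<le> n" and "1 \<le> m"
    and "N = 2 ^ n" and "M = 2 ^ m" and "M \<noteq> 4"
    and "Z = mat2 \<alpha> \<beta> \<gamma> \<delta>" and "in_GL2 N Z"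
    and "J = mat2 0 1 1 0"
    and "\<tau> = \<alpha> + \<delta>" and "\<nu> = \<alpha> * \<delta> - \<beta> * \<gamma>"
    and "G = ext_group N M \<alpha> \<beta> \<gamma> \<delta> r s c"
    and "a = ext_elem N M \<alpha> \<beta> \<gamma> \<delta> r s c Ga"
    and "b = ext_elem N M \<alpha> \<beta> \<gamma> \<delta> r s c Gb"
    and "t = ext_elem N M \<alpha> \<beta> \<gamma> \<delta> r s c Gt"
    and "z = ext_elem N M \<alpha> \<beta> \<gamma> \<delta> r s c Gz"
    and "H = generate G {a, b, t}"
    and "K = generate G {z}"
    and "B = generate G {a, b}"
    \<comment> \<open>the representatives of \<open>1 - 2c\<close> and \<open>-2c\<close> in \<open>{0, \<dots>, M - 1}\<close>\<close>
    and "k = nat ((1 - 2 * c) mod int M)"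
    and "e = nat ((- 2 * c) mod int M)"
  shows
    "((exact_product G H K \<and>
       G\<lparr>carrier := H\<rparr> \<cong> wreathed_group n \<and>
       G\<lparr>carrier := K\<rparr> \<cong> integer_mod_group (2 ^ m) \<and>
       B \<lhd> G)
      \<longleftrightarrow>
      (([A_seq \<tau> \<nu> M * \<alpha> + B_seq \<tau> \<nu> M = 1] (mod int N) \<and>
        [A_seq \<tau> \<nu> M * \<beta> = 0] (mod int N) \<and>
        [A_seq \<tau> \<nu> M * \<gamma> = 0] (mod int N) \<and>
        [A_seq \<tau> \<nu> M * \<delta> + B_seq \<tau> \<nu> M = 1] (mod int N)) \<and>
       ([A_seq \<tau> \<nu> k * \<alpha> + B_seq \<tau> \<nu> k = \<delta>] (mod int N) \<and>
        [A_seq \<tau> \<nu> k * \<beta> = \<gamma>] (mod int N) \<and>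
        [A_seq \<tau> \<nu> k * \<gamma> = \<beta>] (mod int N) \<and>
        [A_seq \<tau> \<nu> k * \<delta> + B_seq \<tau> \<nu> k = \<alpha>] (mod int N)) \<and>
       [(1 - 2 * c)\<^sup>2 = 1] (mod int M) \<and>
       vec_cong N (vector [r, s] v* (mat_power Z e ** (S_mat k (mat_power Z k) + J))) 0 \<and>
       vec_cong N (vector [r, s] v* (mat_power Z e ** S_mat M (mat_power Z k))) 0))
     \<and>
     (vec_cong N (vector [r, s] v* (mat_power Z e ** (S_mat k (mat_power Z k) + J))) 0
      \<longleftrightarrow>
      vec_cong N (((transpose (S_mat k (mat_power Z k)) + J) ** transpose (mat_power Z e))
                    *v vector [r, s]) 0)"
proof -
  define u :: "int ^ 2" where "u = - (vector [r, s] v* mat_power Z e)"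
  have "0 < M"
    using assms by simp
  then have "[int k = 1 - 2 * c] (mod int M)" "[int e = - 2 * c] (mod int M)"
    using assms by (simp_all add: cong_def)
  with \<open>0 < M\<close> interpret ext_params N M k e \<alpha> \<beta> \<gamma> \<delta> r s c Z J u
    using assms by unfold_locales (simp_all only: u_def)
  interpret ext_quadruple N M k e \<alpha> \<beta> \<gamma> \<delta> r s c Z J u G a b t z
    using ext_group_quadruple unfolding assms by simp
  have carrier: "carrier G = generate G {a, b, t, z}"
    using carrier_ext_group assms by simp
  have "subgroup H G" "subgroup K G"
    unfolding \<open>H = _\<close> \<open>K = _\<close> by (simp_all add: generate_is_subgroup)
  then have exact: "exact_product G H K \<longleftrightarrow> H \<inter> K = {\<one>\<^bsub>G\<^esub>}"
    using carrier generate_product assms by (simp add: exact_product_def)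
  have H: "G\<lparr>carrier := H\<rparr> \<cong> wreathed_group n \<longleftrightarrow> faithful"
    unfolding \<open>H = _\<close>
    by (rule iso_wreathed_group_iff_faithful[OF \<open>N = 2 ^ n\<close> card_wreathed_group])
  have K: "G\<lparr>carrier := K\<rparr> \<cong> integer_mod_group (2 ^ m) \<longleftrightarrow> ord z = M"
    using iso_integer_mod_group_iff_ord[OF z_closed \<open>0 < M\<close>] assms by simp
  have "B \<lhd> G"
    using base_normal[OF carrier] assms by simp
  moreover have "H \<inter> K = {\<one>\<^bsub>G\<^esub>} \<and> faithful \<and> ord z = M \<longleftrightarrow> consistent"
    using exact_imp_consistent consistent_imp_faithful consistent_imp_ord consistent_imp_disjoint
      assms by auto
  ultimately have main: "exact_product G H K \<and> G\<lparr>carrier := H\<rparr> \<cong> wreathed_group n \<and>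
      G\<lparr>carrier := K\<rparr> \<cong> integer_mod_group (2 ^ m) \<and> B \<lhd> G \<longleftrightarrow> consistent"
    using exact H K by blast
  have "transpose (mat_power Z e ** (S_mat k (mat_power Z k) + J))
      = (transpose (S_mat k (mat_power Z k)) + J) ** transpose (mat_power Z e)"
    using \<open>J = _\<close>
    by (simp add: matrix_transpose_mul)
      (simp add: vec_eq_iff forall_2 transpose_def mat2_def matrix_matrix_mult_def sum_2)
  then have "((transpose (S_mat k (mat_power Z k)) + J) ** transpose (mat_power Z e)) *v vector [r, s]
      = vector [r, s] v* (mat_power Z e ** (S_mat k (mat_power Z k) + J))"
    by (metis transpose_matrix_vector)
  then show ?thesis
    using main consistent_iff unfolding \<open>\<tau> = _\<close> \<open>\<nu> = _\<close> by simp
qed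

end
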